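(* Let $\Omega\subset\mathbb{C}^n$ be a bounded domain and let $f:\overline{\Omega}\to\mathbb{R}$ be a positive continuous function. Let $u:\overline{\Omega}\to\mathbb{R}$ be a bounded upper semi-continuous function which is a viscosity subsolution of $\Lambda_1(D^2_{\mathbb{C}}w)=f$ in $\Omega$, and let $v:\overline{\Omega}\to\mathbb{R}$ be a bounded lower semi-continuous function which is a viscosity supersolution of $\Lambda_1(D^2_{\mathbb{C}}w)=f$ in $\Omega$. If $u\le v$ on $\partial\Omega$, then $u\le v$ on $\Omega$.
   Context: For a $C^2$ function $w$, $D^2_{\mathbb{C}}w=\left(\frac{\partial^2 w}{\partial z_j\partial\bar z_k}\right)_{1\le j,k\le n}$ is the complex Hessian matrix, and $\Lambda_1(A)$ denotes the smallest eigenvalue of a Hermitian matrix $A$. A function $q$ that is $C^2$ in a neighborhood of $z_0\in\Omega$ touches $w$ from above (resp. from below) at $z_0$ if $q(z_0)=w(z_0)$ and $q\ge w$ (resp. $q\le w$) in a neighborhood of $z_0$. Viscosity subsolution of $\Lambda_1(D^2_{\mathbb{C}}w)=f$ in $\Omega$: an upper semi-continuous function $w$ (not identically $-\infty$) such that for every $z_0\in\Omega$ and every $C^2$ function $q$ touching $w$ from above at $z_0$, $\Lambda_1(D^2_{\mathbb{C}}q)(z_0)\ge f(z_0)$. Viscosity supersolution of $\Lambda_1(D^2_{\mathbb{C}}w)=f$ in $\Omega$: a lower semi-continuous function $w$ such that for every $z_0\in\Omega$ and every $C^2$ function $q$ touching $w$ from below at $z_0$, $[\Lambda_1(D^2_{\mathbb{C}}q)(z_0)]^+\le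 f(z_0)$, where $[t]^+=\max(t,0)$. *)

theory Defs
  imports "HOL-Analysis.Analysis"
begin

definition usc_on :: "'a::topological_space set \<Rightarrow> ('a \<Rightarrow> 'b::linorder) \<Rightarrow> bool" where
  "usc_on S w \<longleftrightarrow> (\<forall>x\<in>S. \<forall>c. w x < c \<longrightarrow> (\<forall>\<^sub>F y in at x within S. w y < c))"

definition lsc_on :: "'a::topological_space set \<Rightarrow> ('a \<Rightarrow> 'b::linorder) \<Rightarrow> bool" where
  "lsc_on S w \<longleftrightarrow> (\<forall>x\<in>S. \<forall>c. c < w x \<longrightarrow> (\<forall>\<^sub>F y in at x within S. c < w y))"

definition C2_on :: "'a::real_normed_vector set \<Rightarrow> ('a \<Rightarrow> 'b::real_normed_vector) \<Rightarrow> bool" where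
  "C2_on U q \<longleftrightarrow>
     (\<exists>(q' :: 'a \<Rightarrow> 'a \<Rightarrow>\<^sub>L 'b) (q'' :: 'a \<Rightarrow> 'a \<Rightarrow>\<^sub>L 'a \<Rightarrow>\<^sub>L 'b).
        (\<forall>z\<in>U. (q has_derivative blinfun_apply (q' z)) (at z)) \<and>
        (\<forall>z\<in>U. (q' has_derivative blinfun_apply (q'' z)) (at z)) \<and>
        continuous_on U q'')"

definition C2_near :: "'a::real_normed_vector \<Rightarrow> ('a \<Rightarrow> 'b::real_normed_vector) \<Rightarrow> bool" where
  "C2_near z0 q \<longleftrightarrow> (\<exists>U. open U \<and> z0 \<in> U \<and> C2_on U q)"

definition dir_deriv :: "'a::real_normed_vector \<Rightarrow> ('a \<Rightarrow> 'b::real_normed_vector) \<Rightarrow> 'a \<Rightarrow> 'b" where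
  "dir_deriv e g z = vector_derivative (\<lambda>t::real. g (z + t *\<^sub>R e)) (at 0)"

text \<open>The Wirtinger operators
  \<open>\<partial>/\<partial>z\<^sub>j = (\<partial>/\<partial>x\<^sub>j - \<i> \<partial>/\<partial>y\<^sub>j) / 2\<close> and
  \<open>\<partial>/\<partial>\<zeta>\<^sub>j = (\<partial>/\<partial>x\<^sub>j + \<i> \<partial>/\<partial>y\<^sub>j) / 2\<close>, where \<open>\<zeta>\<^sub>j\<close> is the conjugate of
  \<open>z\<^sub>j = x\<^sub>j + \<i> y\<^sub>j\<close>.\<close>

definition wirtinger :: "'n::finite \<Rightarrow> (complex ^ 'n \<Rightarrow> complex) \<Rightarrow> complex ^ 'n \<Rightarrow> complex" where
  "wirtinger j g z = (dir_deriv (axis j 1) g z - \<i> * dir_deriv (axis j \<i>) g z) / 2"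

definition wirtinger_bar :: "'n::finite \<Rightarrow> (complex ^ 'n \<Rightarrow> complex) \<Rightarrow> complex ^ 'n \<Rightarrow> complex" where
  "wirtinger_bar j g z = (dir_deriv (axis j 1) g z + \<i> * dir_deriv (axis j \<i>) g z) / 2"

definition complex_hessian :: "(complex ^ 'n \<Rightarrow> real) \<Rightarrow> complex ^ 'n \<Rightarrow> complex ^ 'n ^ 'n" where
  "complex_hessian q z = (\<chi> j k. wirtinger j (wirtinger_bar k (\<lambda>x. complex_of_real (q x))) z)"

text \<open>Used for Hermitian matrices only, whose eigenvalues form a finite nonempty set of reals.\<close>

definition smallest_eigenvalue :: "complex ^ 'n ^ 'n \<Rightarrow> real" where
  "smallest_eigenvalue A = Min {l. \<exists>v. v \<noteq> 0 \<and> A *v v = complex_of_real l *s v}"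

text \<open>In the following four definitions \<open>\<Omega>\<close> is meant to be open and \<open>z0 \<in> \<Omega>\<close>, so that the values
  of \<open>w\<close> outside \<open>\<Omega>\<close> are irrelevant for the filter \<open>nhds z0\<close>. Subsolutions may take the value
  \<open>-\<infinity>\<close> and supersolutions the value \<open>\<infinity>\<close>; there is no touching at such points.\<close>

definition touches_above :: "('a::topological_space \<Rightarrow> real) \<Rightarrow> ('a \<Rightarrow> ereal) \<Rightarrow> 'a \<Rightarrow> bool" where
  "touches_above q w z0 \<longleftrightarrow> ereal (q z0) = w z0 \<and> (\<forall>\<^sub>F z in nhds z0. w z \<le> ereal (q z))"

definition touches_below :: "('a::topological_space \<Rightarrow> real) \<Rightarrow> ('a \<Rightarrow> ereal) \<Rightarrow> 'a \<Rightarrow> bool" where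
  "touches_below q w z0 \<longleftrightarrow> ereal (q z0) = w z0 \<and> (\<forall>\<^sub>F z in nhds z0. ereal (q z) \<le> w z)"

definition viscosity_subsolution ::
    "(complex ^ 'n) set \<Rightarrow> (complex ^ 'n \<Rightarrow> real) \<Rightarrow> (complex ^ 'n \<Rightarrow> ereal) \<Rightarrow> bool" where
  "viscosity_subsolution \<Omega> f w \<longleftrightarrow>
     usc_on \<Omega> w \<and> (\<forall>z\<in>\<Omega>. w z < \<infinity>) \<and> (\<exists>z\<in>\<Omega>. w z \<noteq> -\<infinity>) \<and>
     (\<forall>z0\<in>\<Omega>. \<forall>q. C2_near z0 q \<and> touches_above q w z0 \<longrightarrow>
        smallest_eigenvalue (complex_hessian q z0) \<ge> f z0)"

definition viscosity_supersolution ::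
    "(complex ^ 'n) set \<Rightarrow> (complex ^ 'n \<Rightarrow> real) \<Rightarrow> (complex ^ 'n \<Rightarrow> ereal) \<Rightarrow> bool" where
  "viscosity_supersolution \<Omega> f w \<longleftrightarrow>
     lsc_on \<Omega> w \<and> (\<forall>z\<in>\<Omega>. -\<infinity> < w z) \<and>
     (\<forall>z0\<in>\<Omega>. \<forall>q. C2_near z0 q \<and> touches_below q w z0 \<longrightarrow>
        max (smallest_eigenvalue (complex_hessian q z0)) 0 \<le> f z0)"

end

theory Submission
  imports Defs
begin

text \<open>
  The matrix inequality \<open>\<Lambda>\<^sub>1(D\<^sup>2\<^sub>\<complex>q) \<ge> c\<close> says that for every direction
  \<open>\<xi>\<close> the Laplacian of \<open>q\<close> along the complex line spanned by \<open>\<xi>\<close> is at least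
  \<open>4 c |\<xi>|\<^sup>2\<close>. The subsolution condition is therefore a family of linear conditions, so it survives
  averaging over translations, and a subsolution can be replaced by a smooth one. A smooth strict
  subsolution is compared with \<open>v\<close> directly: at an interior minimum of the difference it is, up to a
  constant, a test function touching \<open>v\<close> from below.

  To average, the viscosity condition has to be turned into an integral inequality. First \<open>u\<close> is
  replaced by the sup-convolution \<open>w(x) = sup\<^sub>y (u(y) - L |x - y|)\<close>, which is Lipschitz and inherits
  the subsolution property with a slightly smaller right-hand side, because a test function for
  \<open>w\<close> at \<open>x\<close> can be translated to the point where the supremum is attained
  (\<open>viscosity_levi_ge_sup_convolution\<close>). Being continuous, \<open>w\<close> satisfies
  \<open>w(z) + c |\<eta>|\<^sup>2 \<le> mean of w over the circle z + e\<^sup>i\<^sup>\<theta> \<eta>\<close>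
  (\<open>circle_mean_ge_of_viscosity\<close>): otherwise \<open>w\<close> exceeds at the centre of the disc a function
  \<open>Re p(\<zeta>) + c |\<eta>|\<^sup>2 |\<zeta>|\<^sup>2 + const\<close>, \<open>p\<close> a polynomial, that lies above \<open>w\<close> on the circle, and adding a large quadratic penalty
  transversal to the disc produces a forbidden test function. The polynomial comes from the
  Stone-Weierstrass theorem on the circle.

  The circle inequality passes to the convolution \<open>W\<close> of \<open>w\<close> with a mollifier by Fubini, and for the
  twice differentiable \<open>W\<close> a second-order expansion turns it back into a lower bound for the complex
  Hessian (\<open>levi_ge_of_circle_mean_ge\<close>, \<open>smooth_approximation\<close>). Adding
  \<open>\<delta> (|z|\<^sup>2 - R\<^sup>2)\<close> makes \<open>W\<close> strict. If \<open>u > v\<close> somewhere, the minimum of \<open>v\<close> minus this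
  function is clearly negative; it cannot lie near the boundary, where \<open>u \<le> v\<close> and semicontinuity
  give \<open>u(y) < v(x) + \<epsilon>\<close> for all close \<open>x\<close> and \<open>y\<close>
  (\<open>ordered_on_compact_imp_uniformly_nearly_ordered\<close>), and it cannot lie in the interior, by the
  supersolution property of \<open>v\<close>.
\<close>

section \<open>Smallest eigenvalues of self-adjoint operators\<close>

text \<open>Eigenvectors of a self-adjoint operator to distinct eigenvalues are orthogonal, hence linearly
  independent, so there are only finitely many eigenvalues. This makes the minimum that defines
  \<^const>\<open>smallest_eigenvalue\<close> meaningful.\<close>

lemma finite_real_eigenvalues_selfadjoint:
  fixes T :: "'a::euclidean_space \<Rightarrow> 'a"
  assumes sa: "\<And>x y. x \<bullet> T y = T x \<bullet> y"
  shows "finite {l. \<exists>v. v \<noteq> 0 \<and> T v = l *\<^sub>R v}" (is "finite ?E")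
proof -
  define e where "e l = (SOME v. v \<noteq> 0 \<and> T v = l *\<^sub>R v)" for l
  have e: "e l \<noteq> 0 \<and> T (e l) = l *\<^sub>R e l" if "l \<in> ?E" for l
    unfolding e_def by (rule someI_ex) (use that in simp)
  have orth: "orthogonal (e l) (e m)" if "l \<in> ?E" "m \<in> ?E" "l \<noteq> m" for l m
  proof -
    have "m * (e l \<bullet> e m) = l * (e l \<bullet> e m)"
      using sa[of "e l" "e m"] e[OF that(1)] e[OF that(2)] by simp
    then show ?thesis using that(3) by (simp add: orthogonal_def)
  qed
  have inj: "inj_on e ?E"
  proof (rule inj_onI, rule ccontr)
    fix l m assume *: "l \<in> ?E" "m \<in> ?E" "e l = e m" "l \<noteq> m"
    then have "orthogonal (e l) (e l)" using orth[of l m] by simp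
    then show False using e[OF *(1)] by (simp add: orthogonal_def)
  qed
  have "pairwise orthogonal (e ` ?E)"
    unfolding pairwise_def using orth by blast
  moreover have "0 \<notin> e ` ?E" using e by fastforce
  ultimately have "independent (e ` ?E)" by (rule pairwise_orthogonal_independent)
  then have "finite (e ` ?E)" by (rule independent_imp_finite)
  then show ?thesis using inj by (rule finite_imageD)
qed

text \<open>A minimiser of the quadratic form on the unit sphere is an eigenvector: the form
  \<open>x \<mapsto> x \<bullet> T x - m |x|\<^sup>2\<close> is nonnegative and vanishes at \<open>v\<close>, so its first variation at \<open>v\<close> vanishes.\<close>

lemma selfadjoint_minimal_Rayleigh_eigenvalue:
  fixes T :: "'a::euclidean_space \<Rightarrow> 'a"
  assumes lin: "linear T" and sa: "\<And>x y. x \<bullet> T y = T x \<bullet> y"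
  obtains m v where "v \<noteq> 0" "T v = m *\<^sub>R v" "\<And>x. m * (norm x)\<^sup>2 \<le> x \<bullet> T x"
proof -
  interpret linear T by (rule lin)
  obtain b :: 'a where b: "b \<in> Basis" by (meson nonempty_Basis ex_in_conv)
  have cont: "continuous_on (sphere 0 1) (\<lambda>x. x \<bullet> T x)"
    by (intro continuous_intros linear_continuous_on linear_conv_bounded_linear[THEN iffD1] lin)
  have "sphere (0::'a) 1 \<noteq> {}" using b by (auto simp: norm_Basis intro!: exI[of _ b])
  then obtain v where v: "v \<in> sphere 0 1" and vmin: "\<And>x. x \<in> sphere 0 1 \<Longrightarrow> v \<bullet> T v \<le> x \<bullet> T x"
    using continuous_attains_inf[OF compact_sphere _ cont] by blast
  define m where "m = v \<bullet> T v"
  have ray: "m * (norm x)\<^sup>2 \<le> x \<bullet> T x" for x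
  proof (cases "x = 0")
    case False
    define y where "y = (1 / norm x) *\<^sub>R x"
    have "y \<in> sphere 0 1" using False by (simp add: y_def)
    then have "m \<le> y \<bullet> T y" unfolding m_def by (rule vmin)
    also have "y \<bullet> T y = (x \<bullet> T x) / (norm x)\<^sup>2"
      by (simp add: y_def scale power2_eq_square)
    finally show ?thesis using False by (simp add: field_simps)
  qed (simp add: zero)
  have nv: "v \<bullet> v = 1" using v by (simp add: norm_eq_1)
  have "w \<bullet> (T v - m *\<^sub>R v) = 0" for w
  proof -
    define \<alpha> where "\<alpha> = w \<bullet> T w - m * (w \<bullet> w)"
    define \<beta> where "\<beta> = w \<bullet> (T v - m *\<^sub>R v)"
    have al: "\<alpha> \<ge> 0" using ray[of w] by (simp add: \<alpha>_def power2_norm_eq_inner)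
    have key: "0 \<le> 2 * t * \<beta> + t\<^sup>2 * \<alpha>" for t
    proof -
      have "w \<bullet> T v = v \<bullet> T w" using sa[of w v] by (simp add: inner_commute)
      then have "(v + t *\<^sub>R w) \<bullet> T (v + t *\<^sub>R w) - m * ((v + t *\<^sub>R w) \<bullet> (v + t *\<^sub>R w))
        = 2 * t * \<beta> + t\<^sup>2 * \<alpha>"
        using nv m_def by (simp add: add scale inner_simps \<alpha>_def \<beta>_def algebra_simps power2_eq_square inner_commute[of w v])
      then show ?thesis using ray[of "v + t *\<^sub>R w"] by (simp add: power2_norm_eq_inner)
    qed
    show ?thesis
    proof (rule ccontr)
      assume "w \<bullet> (T v - m *\<^sub>R v) \<noteq> 0"
      then have b0: "\<beta> \<noteq> 0" by (simp add: \<beta>_def)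
      \<comment> \<open>Along this multiple of \<open>w\<close> the linear term dominates the quadratic one.\<close>
      have "2 * (- \<beta> / (\<alpha> + 1)) * \<beta> + (- \<beta> / (\<alpha> + 1))\<^sup>2 * \<alpha> = - (\<beta>\<^sup>2 * (\<alpha> + 2)) / (\<alpha> + 1)\<^sup>2"
        using al by (simp add: divide_simps power2_eq_square) (simp add: algebra_simps)
      moreover have "\<beta>\<^sup>2 * (\<alpha> + 2) / (\<alpha> + 1)\<^sup>2 > 0" using b0 al by (intro divide_pos_pos mult_pos_pos) auto
      ultimately show False using key[of "- \<beta> / (\<alpha> + 1)"] by simp
    qed
  qed
  from this[of "T v - m *\<^sub>R v"] have "T v = m *\<^sub>R v" by simp
  moreover have "v \<noteq> 0" using nv by auto
  ultimately show ?thesis using that ray by blast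
qed

lemma of_real_scalar_mult_vec: "complex_of_real l *s v = l *\<^sub>R v"
proof -
  have "(l *\<^sub>R v) $ i = complex_of_real l * v $ i" for i
    unfolding vector_scaleR_component by (rule scaleR_conv_of_real)
  then show ?thesis by (simp add: vec_eq_iff)
qed

text \<open>The eigenvalues in question are real, so \<open>\<complex>\<^sup>n\<close> can be treated as a real inner product space.\<close>

lemma smallest_eigenvalue_eq_Min_selfadjoint:
  "smallest_eigenvalue A = Min {l. \<exists>v. v \<noteq> 0 \<and> A *v v = l *\<^sub>R v}"
  by (simp add: smallest_eigenvalue_def of_real_scalar_mult_vec)

lemma linear_complex_matrix_vector: "linear (\<lambda>v. A *v v :: complex ^ 'n)" for A :: "complex ^ 'n ^ 'n"
  by (rule linearI) (auto simp: matrix_vector_mult_def vec_eq_iff sum.distrib algebra_simps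
      scaleR_sum_right)

lemma smallest_eigenvalue_le_Rayleigh:
  fixes A :: "complex ^ 'n ^ 'n"
  assumes sa: "\<And>x y. x \<bullet> (A *v y) = (A *v x) \<bullet> y"
  shows "smallest_eigenvalue A * (norm x)\<^sup>2 \<le> x \<bullet> (A *v x)"
proof -
  obtain m v where m: "v \<noteq> 0" "A *v v = m *\<^sub>R v" "\<And>x. m * (norm x)\<^sup>2 \<le> x \<bullet> (A *v x)"
    using selfadjoint_minimal_Rayleigh_eigenvalue[OF linear_complex_matrix_vector[of A] sa] by metis
  have "smallest_eigenvalue A \<le> m"
    unfolding smallest_eigenvalue_eq_Min_selfadjoint
    by (rule Min_le) (use finite_real_eigenvalues_selfadjoint[OF sa] m in auto)
  then have "smallest_eigenvalue A * (norm x)\<^sup>2 \<le> m * (norm x)\<^sup>2" by (rule mult_right_mono) simp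
  then show ?thesis using m(3)[of x] by simp
qed

lemma smallest_eigenvalue_ge:
  fixes A :: "complex ^ 'n ^ 'n"
  assumes sa: "\<And>x y. x \<bullet> (A *v y) = (A *v x) \<bullet> y"
    and lb: "\<And>x. c * (norm x)\<^sup>2 \<le> x \<bullet> (A *v x)"
  shows "c \<le> smallest_eigenvalue A"
proof -
  let ?E = "{l. \<exists>v. v \<noteq> 0 \<and> A *v v = l *\<^sub>R v}"
  have "?E \<noteq> {}"
    using selfadjoint_minimal_Rayleigh_eigenvalue[OF linear_complex_matrix_vector[of A] sa] by blast
  moreover have "finite ?E" by (rule finite_real_eigenvalues_selfadjoint[OF sa])
  ultimately have "Min ?E \<in> ?E" by (rule Min_in[rotated])
  then obtain v where v: "v \<noteq> 0" "A *v v = Min ?E *\<^sub>R v" by blast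
  have "c * (norm v)\<^sup>2 \<le> Min ?E * (norm v)\<^sup>2"
    using lb[of v] unfolding v(2) by (simp add: power2_norm_eq_inner)
  then show ?thesis using v(1) unfolding smallest_eigenvalue_eq_Min_selfadjoint by simp
qed

section \<open>The Levi form of a function with continuous second derivative\<close>

text \<open>The predicate carries the second derivative explicitly, since the Levi form is read off from it.
  Symmetry is made part of it: it is immediate for each of the functions constructed below and
  inherited by sums, translates and convolutions.\<close>

definition has_hessian_on ::
    "'a::real_normed_vector set \<Rightarrow> ('a \<Rightarrow> real) \<Rightarrow> ('a \<Rightarrow> 'a \<Rightarrow>\<^sub>L 'a \<Rightarrow>\<^sub>L real) \<Rightarrow> bool" where
  "has_hessian_on U q q'' \<longleftrightarrow>
     (\<exists>q'. (\<forall>z\<in>U. (q has_derivative blinfun_apply (q' z)) (at z)) \<and>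
           (\<forall>z\<in>U. (q' has_derivative blinfun_apply (q'' z)) (at z))) \<and>
     continuous_on U q'' \<and> (\<forall>z\<in>U. \<forall>a b. q'' z a b = q'' z b a)"

text \<open>If \<open>B\<close> is the second derivative of \<open>q\<close> at \<open>z\<close>, this is a quarter of the Laplacian of
  \<open>\<zeta> \<mapsto> q(z + \<zeta> \<xi>)\<close> at \<open>\<zeta> = 0\<close>, that is, its mixed second derivative in \<open>\<zeta>\<close> and the conjugate
  of \<open>\<zeta>\<close>.\<close>

definition levi :: "((complex ^ 'n) \<Rightarrow>\<^sub>L (complex ^ 'n) \<Rightarrow>\<^sub>L real) \<Rightarrow> complex ^ 'n \<Rightarrow> real" where
  "levi B \<xi> = (B \<xi> \<xi> + B (\<i> *s \<xi>) (\<i> *s \<xi>)) / 4"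

lemma C2_near_has_hessian:
  assumes "has_hessian_on U q q''" "open U" "z \<in> U"
  shows "C2_near z q"
  using assms unfolding has_hessian_on_def C2_near_def C2_on_def by blast

lemma vec_decomposition:
  fixes w :: "complex ^ 'n"
  shows "w = (\<Sum>j\<in>UNIV. Re (w $ j) *\<^sub>R axis j 1 + Im (w $ j) *\<^sub>R axis j \<i>)"
proof -
  have "(\<Sum>j\<in>UNIV. Re (w $ j) *\<^sub>R axis j 1 + Im (w $ j) *\<^sub>R axis j \<i>) $ k = w $ k" for k
  proof -
    have "(\<Sum>j\<in>UNIV. Re (w $ j) *\<^sub>R axis j 1 + Im (w $ j) *\<^sub>R axis j \<i>) $ k
      = (\<Sum>j\<in>UNIV. if k = j then w $ k else 0)"
      unfolding sum_component by (rule sum.cong) (auto simp: axis_def complex_eq_iff)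
    then show ?thesis by simp
  qed
  then show ?thesis by (simp add: vec_eq_iff)
qed

lemma dir_deriv_of_has_derivative:
  assumes "(g has_derivative D) (at z)"
  shows "dir_deriv e g z = D e"
proof -
  have "((\<lambda>t::real. z + t *\<^sub>R e) has_derivative (\<lambda>t. t *\<^sub>R e)) (at 0)"
    by (auto intro!: derivative_eq_intros)
  then have "((\<lambda>t::real. g (z + t *\<^sub>R e)) has_derivative (\<lambda>t. D (t *\<^sub>R e))) (at 0)"
    using has_derivative_compose[of "\<lambda>t::real. z + t *\<^sub>R e" _ 0 UNIV g D] assms by simp
  moreover have "D (t *\<^sub>R e) = t *\<^sub>R D e" for t
    using assms by (meson has_derivative_bounded_linear bounded_linear.linear linear_cmul)
  ultimately have "((\<lambda>t::real. g (z + t *\<^sub>R e)) has_vector_derivative D e) (at 0)"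
    by (simp add: has_vector_derivative_def)
  then show ?thesis unfolding dir_deriv_def by (rule vector_derivative_at)
qed

lemma complex_hessian_entry:
  fixes q :: "complex ^ 'n \<Rightarrow> real"
  assumes q: "has_hessian_on U q q''" and U: "open U" "z \<in> U"
  shows "complex_hessian q z $ j $ k =
    (Complex (q'' z (axis j 1) (axis k 1) + q'' z (axis j \<i>) (axis k \<i>))
             (q'' z (axis j 1) (axis k \<i>) - q'' z (axis j \<i>) (axis k 1))) / 4"
proof -
  obtain q' where q1: "\<And>z. z \<in> U \<Longrightarrow> (q has_derivative blinfun_apply (q' z)) (at z)"
    and q2: "\<And>z. z \<in> U \<Longrightarrow> (q' has_derivative blinfun_apply (q'' z)) (at z)"
    using q unfolding has_hessian_on_def by blast
  define g where "g x = (complex_of_real (q' x (axis k 1)) + \<i> * complex_of_real (q' x (axis k \<i>))) / 2" for x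
  have wb: "wirtinger_bar k (\<lambda>x. complex_of_real (q x)) x = g x" if "x \<in> U" for x
  proof -
    have "((\<lambda>x. complex_of_real (q x)) has_derivative (\<lambda>h. complex_of_real (q' x h))) (at x)"
      by (rule bounded_linear.has_derivative[OF bounded_linear_of_real q1[OF that]])
    then show ?thesis
      unfolding wirtinger_bar_def g_def by (simp add: dir_deriv_of_has_derivative)
  qed
  define D where "D h = (complex_of_real (q'' z h (axis k 1)) + \<i> * complex_of_real (q'' z h (axis k \<i>))) / 2" for h
  have *: "((\<lambda>x. complex_of_real (q' x e)) has_derivative (\<lambda>h. complex_of_real (q'' z h e))) (at z)" for e
    by (rule bounded_linear.has_derivative[OF bounded_linear_of_real
          bounded_linear.has_derivative[OF blinfun.bounded_linear_left q2[OF U(2)]]])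
  have "(g has_derivative D) (at z)"
    unfolding g_def D_def
    by (intro bounded_linear.has_derivative[OF bounded_linear_divide] has_derivative_add
        has_derivative_mult_right *)
  then have "(wirtinger_bar k (\<lambda>x. complex_of_real (q x)) has_derivative D) (at z)"
    by (rule has_derivative_transform_within_open[OF _ U]) (simp add: wb)
  then show ?thesis
    unfolding complex_hessian_def wirtinger_def
    by (simp add: dir_deriv_of_has_derivative D_def complex_eq_iff)
qed

text \<open>The complex Hessian is Hermitian and its quadratic form is the Levi form. The conjugation arises
  because the row index of the matrix belongs to the holomorphic derivative, whereas \<open>x\<^sup>* A x\<close> pairs
  the row index with the conjugated vector. Both sides are expanded in the real basis \<open>axis j 1\<close>, \<open>axis j \<i>\<close>.\<close>

lemma complex_hessian_form:
  fixes q :: "complex ^ 'n \<Rightarrow> real"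
  assumes q: "has_hessian_on U q q''" and U: "open U" "z \<in> U"
  defines "A \<equiv> complex_hessian q z"
  shows "x \<bullet> (A *v y) = (A *v x) \<bullet> y"
    and "x \<bullet> (A *v x) = levi (q'' z) (\<chi> j. cnj (x $ j))"
proof -
  let ?B = "q'' z"
  have sym: "?B a b = ?B b a" for a b using q U(2) unfolding has_hessian_on_def by blast
  have entry: "A $ j $ k = (Complex (?B (axis j 1) (axis k 1) + ?B (axis j \<i>) (axis k \<i>))
             (?B (axis j 1) (axis k \<i>) - ?B (axis j \<i>) (axis k 1))) / 4" for j k
    unfolding A_def by (rule complex_hessian_entry[OF q U])
  have herm: "A $ j $ k = cnj (A $ k $ j)" for j k
    unfolding entry by (simp add: complex_eq_iff sym[of "axis j _"])
  have form: "x \<bullet> (A *v y) = (\<Sum>j\<in>UNIV. \<Sum>k\<in>UNIV. Re (cnj (x $ j) * A $ j $ k * y $ k))" for x y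
    unfolding inner_vec_def matrix_vector_mult_def
    by (simp add: inner_complex_def sum_distrib_left Re_sum Im_sum sum.distrib [symmetric] algebra_simps)
  have "(A *v x) \<bullet> y = y \<bullet> (A *v x)" by (rule inner_commute)
  also have "\<dots> = (\<Sum>k\<in>UNIV. \<Sum>j\<in>UNIV. Re (cnj (y $ j) * A $ j $ k * x $ k))"
    unfolding form by (rule sum.swap)
  also have "\<dots> = x \<bullet> (A *v y)"
    unfolding form
  proof (intro sum.cong refl)
    fix j k
    have "Re (cnj (y $ k) * A $ k $ j * x $ j) = Re (cnj (cnj (y $ k) * A $ k $ j * x $ j))"
      by (rule cnj.sel(1)[symmetric])
    also have "cnj (cnj (y $ k) * A $ k $ j * x $ j) = cnj (x $ j) * A $ j $ k * y $ k"
      unfolding herm[of j k] by (simp add: mult_ac)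
    finally show "Re (cnj (y $ k) * A $ k $ j * x $ j) = Re (cnj (x $ j) * A $ j $ k * y $ k)" .
  qed
  finally show "x \<bullet> (A *v y) = (A *v x) \<bullet> y" ..
  define a b where "a j = Re (x $ j)" and "b j = - Im (x $ j)" for j
  define w where "w = (\<chi> j. cnj (x $ j))"
  have w: "w = (\<Sum>j\<in>UNIV. a j *\<^sub>R axis j 1 + b j *\<^sub>R axis j \<i>)"
    using vec_decomposition[of w] by (simp add: w_def a_def b_def)
  have iw: "\<i> *s w = (\<Sum>j\<in>UNIV. (- b j) *\<^sub>R axis j 1 + a j *\<^sub>R axis j \<i>)"
    using vec_decomposition[of "\<i> *s w"] by (simp add: w_def a_def b_def)
  have expand: "?B (\<Sum>j\<in>UNIV. c j *\<^sub>R axis j 1 + d j *\<^sub>R axis j \<i>) (\<Sum>j\<in>UNIV. c j *\<^sub>R axis j 1 + d j *\<^sub>R axis j \<i>)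
    = (\<Sum>j\<in>UNIV. \<Sum>k\<in>UNIV. c j * c k * ?B (axis j 1) (axis k 1) + c j * d k * ?B (axis j 1) (axis k \<i>)
        + d j * c k * ?B (axis j \<i>) (axis k 1) + d j * d k * ?B (axis j \<i>) (axis k \<i>))" for c d
    by (simp add: blinfun.sum_right blinfun.sum_left blinfun.bilinear_simps sum_distrib_left
        sum.distrib[symmetric] algebra_simps)
       (subst sum.swap, simp add: algebra_simps)
  have "4 * levi ?B w = (\<Sum>j\<in>UNIV. \<Sum>k\<in>UNIV.
      (a j * a k + b j * b k) * (?B (axis j 1) (axis k 1) + ?B (axis j \<i>) (axis k \<i>))
      + (a j * b k - b j * a k) * (?B (axis j 1) (axis k \<i>) - ?B (axis j \<i>) (axis k 1)))"
    unfolding levi_def iw unfolding w expand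
    by (simp add: sum.distrib[symmetric] algebra_simps)
  also have "\<dots> = 4 * (x \<bullet> (A *v x))"
    unfolding form sum_distrib_left
    by (intro sum.cong refl) (simp add: entry a_def b_def algebra_simps)
  finally show "x \<bullet> (A *v x) = levi ?B (\<chi> j. cnj (x $ j))" by (simp add: w_def)
qed

lemma norm_cnj_vec: "norm (\<chi> j. cnj (x $ j)) = norm x" for x :: "complex ^ 'n"
  by (simp add: norm_vec_def)

text \<open>This lemma and the next one are the only links between eigenvalues and the analysis below,
  which works with Levi forms throughout.\<close>

lemma smallest_eigenvalue_le_levi:
  assumes "has_hessian_on U q q''" "open U" "z \<in> U"
  shows "smallest_eigenvalue (complex_hessian q z) * (norm \<xi>)\<^sup>2 \<le> levi (q'' z) \<xi>"
  using smallest_eigenvalue_le_Rayleigh[OF complex_hessian_form(1)[OF assms], of "\<chi> j. cnj (\<xi> $ j)"]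
    complex_hessian_form(2)[OF assms, of "\<chi> j. cnj (\<xi> $ j)"]
  by (simp add: norm_cnj_vec)

lemma smallest_eigenvalue_ge_levi:
  assumes "has_hessian_on U q q''" "open U" "z \<in> U"
    and lb: "\<And>\<xi>. c * (norm \<xi>)\<^sup>2 \<le> levi (q'' z) \<xi>"
  shows "c \<le> smallest_eigenvalue (complex_hessian q z)"
proof (rule smallest_eigenvalue_ge[OF complex_hessian_form(1)[OF assms(1-3)]])
  fix x show "c * (norm x)\<^sup>2 \<le> x \<bullet> (complex_hessian q z *v x)"
    using lb[of "\<chi> j. cnj (x $ j)"] by (simp add: complex_hessian_form(2)[OF assms(1-3)] norm_cnj_vec)
qed

section \<open>Calculus of Hessians\<close>

lemma has_hessian_onE:
  assumes "has_hessian_on U q q''"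
  obtains q' where "\<forall>z\<in>U. (q has_derivative blinfun_apply (q' z)) (at z)"
    "\<forall>z\<in>U. (q' has_derivative blinfun_apply (q'' z)) (at z)"
  using assms unfolding has_hessian_on_def by (elim conjE exE)

lemma has_hessian_on_continuous: "has_hessian_on U q q'' \<Longrightarrow> continuous_on U q''"
  and has_hessian_on_symmetric: "has_hessian_on U q q'' \<Longrightarrow> z \<in> U \<Longrightarrow> q'' z a b = q'' z b a"
  unfolding has_hessian_on_def by blast+

lemma has_hessian_onI:
  assumes "\<And>z. z \<in> U \<Longrightarrow> (q has_derivative blinfun_apply (q' z)) (at z)"
    and "\<And>z. z \<in> U \<Longrightarrow> (q' has_derivative blinfun_apply (q'' z)) (at z)"
    and "continuous_on U q''" "\<And>z a b. z \<in> U \<Longrightarrow> q'' z a b = q'' z b a"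
  shows "has_hessian_on U q q''"
  unfolding has_hessian_on_def
  by (intro conjI exI[of _ q'] ballI allI assms)

lemma has_hessian_on_imp_continuous_on:
  assumes "has_hessian_on U q q''"
  shows "continuous_on U q"
proof -
  obtain q' where q': "\<forall>z\<in>U. (q has_derivative blinfun_apply (q' z)) (at z)"
    "\<forall>z\<in>U. (q' has_derivative blinfun_apply (q'' z)) (at z)"
    by (rule has_hessian_onE[OF assms])
  show ?thesis
    by (rule has_derivative_continuous_on[of U q "\<lambda>z. blinfun_apply (q' z)"])
       (use q'(1) in \<open>auto intro: has_derivative_at_withinI\<close>)
qed

lemma has_hessian_on_subset:
  assumes q: "has_hessian_on U q q''" and V: "V \<subseteq> U"
  shows "has_hessian_on V q q''"
proof -
  obtain q' where q': "\<forall>z\<in>U. (q has_derivative blinfun_apply (q' z)) (at z)"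
    "\<forall>z\<in>U. (q' has_derivative blinfun_apply (q'' z)) (at z)"
    by (rule has_hessian_onE[OF q])
  show ?thesis
  proof (rule has_hessian_onI[where q' = q'])
    fix z assume "z \<in> V"
    then have z: "z \<in> U" using V by blast
    show "(q has_derivative blinfun_apply (q' z)) (at z)" "(q' has_derivative blinfun_apply (q'' z)) (at z)"
      using q' z by blast+
    show "q'' z a b = q'' z b a" for a b by (rule has_hessian_on_symmetric[OF q z])
  qed (rule continuous_on_subset[OF has_hessian_on_continuous[OF q] V])
qed

lemma has_hessian_on_add:
  assumes "has_hessian_on U p p''" "has_hessian_on U q q''"
  shows "has_hessian_on U (\<lambda>z. p z + q z) (\<lambda>z. p'' z + q'' z)"
proof -
  obtain p' where p': "\<forall>z\<in>U. (p has_derivative blinfun_apply (p' z)) (at z)"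
    "\<forall>z\<in>U. (p' has_derivative blinfun_apply (p'' z)) (at z)"
    by (rule has_hessian_onE[OF assms(1)])
  obtain q' where q': "\<forall>z\<in>U. (q has_derivative blinfun_apply (q' z)) (at z)"
    "\<forall>z\<in>U. (q' has_derivative blinfun_apply (q'' z)) (at z)"
    by (rule has_hessian_onE[OF assms(2)])
  show ?thesis
  proof (rule has_hessian_onI[where q' = "\<lambda>z. p' z + q' z"])
    fix z assume z: "z \<in> U"
    show "((\<lambda>z. p z + q z) has_derivative blinfun_apply (p' z + q' z)) (at z)"
      using has_derivative_add[OF p'(1)[rule_format, OF z] q'(1)[rule_format, OF z]]
      by (simp add: plus_blinfun.rep_eq)
    show "((\<lambda>z. p' z + q' z) has_derivative blinfun_apply (p'' z + q'' z)) (at z)"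
      using has_derivative_add[OF p'(2)[rule_format, OF z] q'(2)[rule_format, OF z]]
      by (simp add: plus_blinfun.rep_eq)
    show "(p'' z + q'' z) a b = (p'' z + q'' z) b a" for a b
      using has_hessian_on_symmetric[OF assms(1) z, of a b] has_hessian_on_symmetric[OF assms(2) z, of a b]
      by (simp add: blinfun.add_left)
  qed (intro continuous_on_add has_hessian_on_continuous[OF assms(1)] has_hessian_on_continuous[OF assms(2)])
qed

lemma has_hessian_on_const: "has_hessian_on U (\<lambda>z. c) (\<lambda>z. 0)"
  by (rule has_hessian_onI[where q' = "\<lambda>z. 0"]) (simp_all add: zero_blinfun.rep_eq)

lemma has_hessian_on_cmult:
  assumes "has_hessian_on U q q''"
  shows "has_hessian_on U (\<lambda>z. c * q z) (\<lambda>z. c *\<^sub>R q'' z)"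
proof -
  obtain q' where q': "\<forall>z\<in>U. (q has_derivative blinfun_apply (q' z)) (at z)"
    "\<forall>z\<in>U. (q' has_derivative blinfun_apply (q'' z)) (at z)"
    by (rule has_hessian_onE[OF assms(1)])
  show ?thesis
  proof (rule has_hessian_onI[where q' = "\<lambda>z. c *\<^sub>R q' z"])
    fix z assume z: "z \<in> U"
    show "((\<lambda>z. c * q z) has_derivative blinfun_apply (c *\<^sub>R q' z)) (at z)"
      using has_derivative_mult_right[OF q'(1)[rule_format, OF z], of c]
      by (simp add: scaleR_blinfun.rep_eq)
    show "((\<lambda>z. c *\<^sub>R q' z) has_derivative blinfun_apply (c *\<^sub>R q'' z)) (at z)"
      using has_derivative_scaleR_right[OF q'(2)[rule_format, OF z], of c]
      by (simp add: scaleR_blinfun.rep_eq)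
    show "(c *\<^sub>R q'' z) a b = (c *\<^sub>R q'' z) b a" for a b
      using has_hessian_on_symmetric[OF assms(1) z, of a b] by (simp add: blinfun.scaleR_left)
  qed (intro continuous_on_scaleR continuous_on_const has_hessian_on_continuous[OF assms(1)])
qed

lemma has_hessian_on_translate:
  assumes "has_hessian_on U q q''"
  shows "has_hessian_on {z. z + a \<in> U} (\<lambda>z. q (z + a)) (\<lambda>z. q'' (z + a))"
proof -
  obtain q' where q': "\<forall>z\<in>U. (q has_derivative blinfun_apply (q' z)) (at z)"
    "\<forall>z\<in>U. (q' has_derivative blinfun_apply (q'' z)) (at z)"
    by (rule has_hessian_onE[OF assms(1)])
  have shift: "((\<lambda>z. z + a) has_derivative (\<lambda>h. h)) (at z)" for z
    by (auto intro!: derivative_eq_intros)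
  show ?thesis
  proof (rule has_hessian_onI[where q' = "\<lambda>z. q' (z + a)"])
    fix z assume z: "z \<in> {z. z + a \<in> U}"
    then have z: "z + a \<in> U" by simp
    show "((\<lambda>z. q (z + a)) has_derivative blinfun_apply (q' (z + a))) (at z)"
      using has_derivative_compose[OF shift q'(1)[rule_format, OF z]] by simp
    show "((\<lambda>z. q' (z + a)) has_derivative blinfun_apply (q'' (z + a))) (at z)"
      using has_derivative_compose[OF shift q'(2)[rule_format, OF z]] by simp
    show "q'' (z + a) c d = q'' (z + a) d c" for c d
      by (rule has_hessian_on_symmetric[OF assms z])
  next
    show "continuous_on {z. z + a \<in> U} (\<lambda>z. q'' (z + a))"
      by (rule continuous_on_compose2[OF has_hessian_on_continuous[OF assms]])
         (auto intro!: continuous_intros)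
  qed
qed

text \<open>All test functions and the mollifier are of the form \<open>\<phi>(A(z - a))\<close> with \<open>A\<close> linear; here \<open>g\<close> is the
  gradient of \<open>\<phi>\<close> and \<open>D\<close> the derivative of \<open>g\<close>.\<close>

lemma has_hessian_on_compose_affine:
  fixes A :: "'a::real_normed_vector \<Rightarrow>\<^sub>L 'b::real_inner"
  assumes \<phi>: "\<And>w. (\<phi> has_derivative (\<lambda>h. g w \<bullet> h)) (at w)"
    and g: "\<And>w. (g has_derivative blinfun_apply (D w)) (at w)"
    and D: "continuous_on UNIV D" "\<And>w a b. D w a \<bullet> b = D w b \<bullet> a"
  obtains q'' where "has_hessian_on U (\<lambda>z. \<phi> (A (z - a))) q''"
    "\<And>z h k. q'' z h k = D (A (z - a)) (A h) \<bullet> A k"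
proof -
  have bl: "bounded_linear (\<lambda>w. blinfun_inner_right w o\<^sub>L A)"
    by (rule bounded_linear_compose[OF bounded_bilinear.bounded_linear_left[OF bounded_bilinear_blinfun_compose]
          bounded_linear_blinfun_inner_right])
  define J where "J = Blinfun (\<lambda>w. blinfun_inner_right w o\<^sub>L A)"
  have J: "J w h = w \<bullet> A h" for w h
    unfolding J_def bounded_linear_Blinfun_apply[OF bl] by simp
  define q'' where "q'' z = J o\<^sub>L D (A (z - a)) o\<^sub>L A" for z
  have q'': "q'' z h k = D (A (z - a)) (A h) \<bullet> A k" for z h k
    by (simp add: q''_def J)
  have aff: "((\<lambda>z. A (z - a)) has_derivative A) (at z)" for z
    by (auto intro!: derivative_eq_intros simp: blinfun.bilinear_simps)
  have "((\<lambda>z. \<phi> (A (z - a))) has_derivative blinfun_apply (J (g (A (z - a))))) (at z)" for z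
    using has_derivative_compose[OF aff[of z] \<phi>[of "A (z - a)"]] by (simp add: J[abs_def])
  moreover have "((\<lambda>z. J (g (A (z - a)))) has_derivative blinfun_apply (q'' z)) (at z)" for z
    using bounded_linear.has_derivative[OF blinfun.bounded_linear_right has_derivative_compose[OF aff[of z] g[of "A (z - a)"]], of J]
    by (simp add: q''_def blinfun_compose.rep_eq o_def)
  moreover have "continuous_on U q''"
    unfolding q''_def
    by (intro bounded_bilinear.continuous_on[OF bounded_bilinear_blinfun_compose] continuous_on_const
        continuous_on_compose2[OF D(1)] continuous_intros) auto
  ultimately have "has_hessian_on U (\<lambda>z. \<phi> (A (z - a))) q''"
    by (intro has_hessian_onI) (auto simp: q'' D(2))
  then show ?thesis by (rule that[OF _ q''])
qed

lemma has_hessian_on_square_affine: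
  fixes A :: "'a::real_normed_vector \<Rightarrow>\<^sub>L 'b::real_inner"
  obtains q'' where "has_hessian_on U (\<lambda>z. (norm (A (z - a)))\<^sup>2) q''"
    "\<And>z h k. q'' z h k = 2 * (A h \<bullet> A k)"
proof -
  have 1: "((\<lambda>w. (norm w)\<^sup>2) has_derivative (\<lambda>h. (2 *\<^sub>R w) \<bullet> h)) (at w)" for w :: 'b
    unfolding power2_norm_eq_inner
    by (auto intro!: derivative_eq_intros simp: inner_commute)
  have 2: "((\<lambda>w. 2 *\<^sub>R w) has_derivative blinfun_apply (2 *\<^sub>R id_blinfun)) (at w)" for w :: 'b
    by (auto intro!: derivative_eq_intros simp: blinfun.scaleR_left)
  obtain q'' where "has_hessian_on U (\<lambda>z. (norm (A (z - a)))\<^sup>2) q''"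
    "\<And>z h k. q'' z h k = (2 *\<^sub>R id_blinfun) (A h) \<bullet> A k"
    by (rule has_hessian_on_compose_affine[OF 1 2, where A = A and U = U and a = a])
       (auto simp: blinfun.scaleR_left inner_commute)
  then show ?thesis using that by (auto simp: blinfun.scaleR_left)
qed

text \<open>The gradient of \<open>Re p\<close> with respect to the real inner product of \<open>\<complex>\<close> is the conjugate
  of the complex derivative of \<open>p\<close>.\<close>

lemma has_hessian_on_Re_poly_affine:
  fixes A :: "'a::real_normed_vector \<Rightarrow>\<^sub>L complex"
  obtains q'' where "has_hessian_on U (\<lambda>z. Re (poly p (A (z - a)))) q''"
    "\<And>z h k. q'' z h k = Re (poly (pderiv (pderiv p)) (A (z - a)) * A h * A k)"
proof -
  have pd: "(poly r has_derivative (\<lambda>h. poly (pderiv r) w * h)) (at w)" for r and w :: complex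
    using poly_DERIV[of r w] by (simp add: has_field_derivative_def)
  have 1: "((\<lambda>w. Re (poly p w)) has_derivative (\<lambda>h. cnj (poly (pderiv p) w) \<bullet> h)) (at w)" for w
    using bounded_linear.has_derivative[OF bounded_linear_Re pd[of p w]]
    by (simp add: inner_complex_def)
  define C where "C = Blinfun cnj"
  have C: "C w = cnj w" for w by (simp add: C_def bounded_linear_Blinfun_apply bounded_linear_cnj)
  define D where "D w = C o\<^sub>L blinfun_mult_right (poly (pderiv (pderiv p)) w)" for w
  have D: "D w h = cnj (poly (pderiv (pderiv p)) w * h)" for w h
    by (simp add: D_def C)
  have 2: "((\<lambda>w. cnj (poly (pderiv p) w)) has_derivative blinfun_apply (D w)) (at w)" for w
    using bounded_linear.has_derivative[OF bounded_linear_cnj pd[of "pderiv p" w]] by (simp add: D[abs_def])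
  have 3: "continuous_on UNIV D"
    unfolding D_def
    by (intro bounded_bilinear.continuous_on[OF bounded_bilinear_blinfun_compose] continuous_on_const
        bounded_linear.continuous_on[OF bounded_linear_blinfun_mult_right] continuous_intros)
  obtain q'' where "has_hessian_on U (\<lambda>z. Re (poly p (A (z - a)))) q''"
    "\<And>z h k. q'' z h k = D (A (z - a)) (A h) \<bullet> A k"
    by (rule has_hessian_on_compose_affine[OF 1 2 3, where A = A and U = U and a = a])
       (auto simp: D inner_complex_def algebra_simps)
  then show ?thesis using that by (auto simp: D inner_complex_def algebra_simps)
qed

lemma norm_smult_vec: "norm (c *s \<eta>) = cmod c * norm \<eta>" for \<eta> :: "complex ^ 'n"
  unfolding norm_vec_def by (simp add: norm_mult L2_set_right_distrib)

text \<open>The function that is added to make a subsolution strict.\<close>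

lemma norm_square_levi:
  obtains q'' :: "complex ^ 'n \<Rightarrow> (complex ^ 'n) \<Rightarrow>\<^sub>L (complex ^ 'n) \<Rightarrow>\<^sub>L real"
  where "has_hessian_on U (\<lambda>z. (norm z)\<^sup>2) q''" "\<And>z \<xi>. levi (q'' z) \<xi> = (norm \<xi>)\<^sup>2"
proof -
  obtain q'' :: "complex ^ 'n \<Rightarrow> (complex ^ 'n) \<Rightarrow>\<^sub>L (complex ^ 'n) \<Rightarrow>\<^sub>L real"
    where q: "has_hessian_on U (\<lambda>z. (norm (id_blinfun (z - 0)))\<^sup>2) q''"
      "\<And>z h k. q'' z h k = 2 * (id_blinfun h \<bullet> id_blinfun k)"
    using has_hessian_on_square_affine[of U id_blinfun 0] by blast
  have "norm (\<i> *s \<xi>) = norm \<xi>" for \<xi> :: "complex ^ 'n" by (simp add: norm_smult_vec)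
  then have "levi (q'' z) \<xi> = (norm \<xi>)\<^sup>2" for z \<xi>
    by (simp add: levi_def q(2) power2_norm_eq_inner[symmetric])
  then show ?thesis using q(1) that by simp
qed

section \<open>Second-order expansion and means over circles\<close>

text \<open>The remainder has derivative \<open>q'(x + h) - q'(x) - q''(x) h\<close>, which is \<open>o(|h|)\<close> by
  differentiability of \<open>q'\<close> at \<open>x\<close>; the mean value inequality gains one more order. Symmetry of the
  second derivative is what brings the derivative of the quadratic term into this form.\<close>

lemma second_order_Taylor:
  assumes q: "has_hessian_on UNIV q q''"
  obtains p :: "'a::real_normed_vector \<Rightarrow>\<^sub>L real"
  where "\<And>e. e > 0 \<Longrightarrow>
    \<exists>d>0. \<forall>h. norm h < d \<longrightarrow> \<bar>q (x + h) - q x - p h - q'' x h h / 2\<bar> \<le> e * (norm h)\<^sup>2"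
proof -
  obtain q' where q'0: "\<forall>z\<in>UNIV. (q has_derivative blinfun_apply (q' z)) (at z)"
    "\<forall>z\<in>UNIV. (q' has_derivative blinfun_apply (q'' z)) (at z)"
    by (rule has_hessian_onE[OF q])
  have q': "(q has_derivative blinfun_apply (q' z)) (at z)" "(q' has_derivative blinfun_apply (q'' z)) (at z)" for z using q'0 by auto
  have sym: "q'' x a b = q'' x b a" for a b by (rule has_hessian_on_symmetric[OF q]) simp
  define R where "R h = q (x + h) - q x - q' x h - q'' x h h / 2" for h
  have dR: "(R has_derivative blinfun_apply (q' (x + h) - q' x - q'' x h)) (at h)" for h
  proof -
    have "((\<lambda>h. x + h) has_derivative (\<lambda>h. h)) (at h)" by (auto intro!: derivative_eq_intros)
    then have 1: "((\<lambda>h. q (x + h)) has_derivative q' (x + h)) (at h)"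
      using has_derivative_compose[of "\<lambda>h. x + h" "\<lambda>h. h" h UNIV q "q' (x + h)"] q'(1)[of "x + h"] by simp
    have 2: "((\<lambda>h. q'' x h h / 2) has_derivative (\<lambda>l. (q'' x h l + q'' x l h) / 2)) (at h)"
      by (intro bounded_linear.has_derivative[OF bounded_linear_divide])
         (auto intro!: derivative_eq_intros)
    have "(R has_derivative (\<lambda>l. q' (x + h) l - 0 - q' x l - (q'' x h l + q'' x l h) / 2)) (at h)"
      unfolding R_def
      by (intro has_derivative_diff 1 2 has_derivative_const bounded_linear_imp_has_derivative
          blinfun.bounded_linear_right)
    then show ?thesis by (simp add: sym[of _ h] minus_blinfun.rep_eq)
  qed
  have "\<exists>d>0. \<forall>h. norm h < d \<longrightarrow> \<bar>R h\<bar> \<le> e * (norm h)\<^sup>2" if e: "e > 0" for e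
  proof -
    obtain d where d: "d > 0"
      "\<And>h. norm h < d \<Longrightarrow> norm (q' (x + h) - q' x - q'' x h) \<le> e * norm h"
    proof -
      obtain d where "d > 0" and d: "\<And>y. norm (y - x) < d \<Longrightarrow> norm (q' y - q' x - q'' x (y - x)) \<le> e * norm (y - x)"
        using q'(2)[of x] e unfolding has_derivative_at_alt by blast
      show ?thesis using that[OF \<open>d > 0\<close>] d[of "x + _"] by simp
    qed
    have "\<bar>R h\<bar> \<le> e * (norm h)\<^sup>2" if h: "norm h < d" for h
    proof -
      have "norm (R h - R 0) \<le> (e * norm h) * norm (h - 0)"
      proof (rule differentiable_bound[of "cball 0 (norm h)" R "\<lambda>h. blinfun_apply (q' (x + h) - q' x - q'' x h)"])
        fix y :: 'a assume y: "y \<in> cball 0 (norm h)"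
        show "(R has_derivative blinfun_apply (q' (x + y) - q' x - q'' x y)) (at y within cball 0 (norm h))"
          using dR by (rule has_derivative_at_withinI)
        have "onorm (blinfun_apply (q' (x + y) - q' x - q'' x y)) = norm (q' (x + y) - q' x - q'' x y)"
          by (simp add: norm_blinfun.rep_eq)
        also have "\<dots> \<le> e * norm y" using d(2)[of y] y h by auto
        also have "\<dots> \<le> e * norm h" using y e by auto
        finally show "onorm (blinfun_apply (q' (x + y) - q' x - q'' x y)) \<le> e * norm h" .
      qed auto
      then show ?thesis by (simp add: R_def power2_eq_square)
    qed
    then show ?thesis using d(1) by blast
  qed
  then show ?thesis using that[of "q' x"] by (simp add: R_def)
qed

definition circle_mean :: "(complex ^ 'n \<Rightarrow> real) \<Rightarrow> complex ^ 'n \<Rightarrow> complex ^ 'n \<Rightarrow> real" where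
  "circle_mean w z \<eta> = integral {0..2 * pi} (\<lambda>\<theta>. w (z + cis \<theta> *s \<eta>)) / (2 * pi)"

lemma cis_smult: "cis \<theta> *s \<eta> = cos \<theta> *\<^sub>R \<eta> + sin \<theta> *\<^sub>R (\<i> *s \<eta>)"
  by (simp add: vec_eq_iff complex_eq_iff)

lemma continuous_on_smult_vec:
  fixes \<eta> :: "complex ^ 'n"
  assumes "continuous_on S f"
  shows "continuous_on S (\<lambda>t. f t *s \<eta>)"
proof -
  have "continuous_on S (\<lambda>t. \<chi> j. f t * \<eta> $ j)"
    by (intro continuous_on_vec_lambda continuous_on_mult assms continuous_on_const)
  then show ?thesis by (simp add: vector_scalar_mult_def)
qed

lemma continuous_on_circle: "continuous_on S (\<lambda>\<theta>. z + cis \<theta> *s \<eta>)"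
  by (intro continuous_intros continuous_on_smult_vec continuous_on_cis)

lemma levi_scaleR: "levi B (t *\<^sub>R \<xi>) = t\<^sup>2 * levi B \<xi>"
proof -
  have "\<i> *s (t *\<^sub>R \<xi>) = t *\<^sub>R (\<i> *s \<xi>)" by (simp add: vec_eq_iff)
  then show ?thesis
    by (simp add: levi_def blinfun.scaleR_left blinfun.scaleR_right power2_eq_square algebra_simps add_divide_distrib)
qed

text \<open>The integral of a second-order Taylor polynomial over a circle: the first-order and the mixed terms
  drop out.\<close>

lemma has_integral_second_order_circle:
  fixes c p1 p2 b11 b12 b22 :: real
  shows "((\<lambda>\<theta>. c + (p1 * cos \<theta> + p2 * sin \<theta>)
      + (b11 * (cos \<theta>)\<^sup>2 + 2 * b12 * (sin \<theta> * cos \<theta>) + b22 * (sin \<theta>)\<^sup>2) / 2)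
    has_integral (2 * pi * c + pi / 2 * (b11 + b22))) {0..2 * pi}"
proof -
  define F where "F \<theta> = c * \<theta> + (p1 * sin \<theta> - p2 * cos \<theta>)
     + (b11 * (\<theta> + sin \<theta> * cos \<theta>) / 2 + b12 * (sin \<theta>)\<^sup>2 + b22 * (\<theta> - sin \<theta> * cos \<theta>) / 2) / 2" for \<theta>
  have "(F has_vector_derivative c + (p1 * cos \<theta> + p2 * sin \<theta>)
      + (b11 * (cos \<theta>)\<^sup>2 + 2 * b12 * (sin \<theta> * cos \<theta>) + b22 * (sin \<theta>)\<^sup>2) / 2) (at \<theta> within {0..2*pi})" for \<theta>
  proof -
    have "(sin \<theta>)\<^sup>2 = 1 - (cos \<theta>)\<^sup>2" by (simp add: sin_squared_eq)
    then have e: "1 + (cos \<theta> * cos \<theta> - sin \<theta> * sin \<theta>) = 2 * (cos \<theta>)\<^sup>2"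
      "1 - (cos \<theta> * cos \<theta> - sin \<theta> * sin \<theta>) = 2 * (sin \<theta>)\<^sup>2"
      by (simp_all add: power2_eq_square)
    have "(F has_field_derivative c + (p1 * cos \<theta> + p2 * sin \<theta>)
      + (b11 * (1 + (cos \<theta> * cos \<theta> - sin \<theta> * sin \<theta>)) / 2 + 2 * b12 * (sin \<theta> * cos \<theta>)
         + b22 * (1 - (cos \<theta> * cos \<theta> - sin \<theta> * sin \<theta>)) / 2) / 2) (at \<theta> within {0..2*pi})"
      unfolding F_def by (auto intro!: derivative_eq_intros simp: field_simps)
    then show ?thesis unfolding e
      by (simp add: has_real_derivative_iff_has_vector_derivative)
  qed
  then have "((\<lambda>\<theta>. c + (p1 * cos \<theta> + p2 * sin \<theta>)
      + (b11 * (cos \<theta>)\<^sup>2 + 2 * b12 * (sin \<theta> * cos \<theta>) + b22 * (sin \<theta>)\<^sup>2) / 2)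
    has_integral (F (2 * pi) - F 0)) {0..2 * pi}"
    by (intro fundamental_theorem_of_calculus) auto
  moreover have "F (2 * pi) - F 0 = 2 * pi * c + pi / 2 * (b11 + b22)"
    by (simp add: F_def algebra_simps)
  ultimately show ?thesis by simp
qed

text \<open>For small \<open>\<eta>\<close> the circle mean is \<open>W(x) + levi(\<eta>) + o(|\<eta>|\<^sup>2)\<close>. Applying the hypothesis to a small
  multiple of \<open>\<xi>\<close> and dividing by the square of the factor gives the claim.\<close>

lemma levi_ge_of_circle_mean_ge:
  fixes W :: "complex ^ 'n \<Rightarrow> real"
  assumes W: "has_hessian_on UNIV W W''" and r: "r > 0"
    and mean: "\<And>\<eta>. norm \<eta> < r \<Longrightarrow> W x + c * (norm \<eta>)\<^sup>2 \<le> circle_mean W x \<eta>"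
  shows "c * (norm \<xi>)\<^sup>2 \<le> levi (W'' x) \<xi>"
proof (rule field_le_epsilon)
  fix e :: real assume e: "e > 0"
  obtain p :: "(complex ^ 'n) \<Rightarrow>\<^sub>L real" where p: "\<And>e. e > 0 \<Longrightarrow>
    \<exists>d>0. \<forall>h. norm h < d \<longrightarrow> \<bar>W (x + h) - W x - p h - W'' x h h / 2\<bar> \<le> e * (norm h)\<^sup>2"
    using second_order_Taylor[OF W] by blast
  define \<epsilon> where "\<epsilon> = e / ((norm \<xi>)\<^sup>2 + 1)"
  have eps: "\<epsilon> > 0" "\<epsilon> * (norm \<xi>)\<^sup>2 \<le> e" using e
    by (auto simp: \<epsilon>_def divide_simps add_nonneg_pos intro!: divide_pos_pos)
  obtain d where d: "d > 0"
    "\<And>h. norm h < d \<Longrightarrow> \<bar>W (x + h) - W x - p h - W'' x h h / 2\<bar> \<le> \<epsilon> * (norm h)\<^sup>2"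
    using p[OF eps(1)] by blast
  \<comment> \<open>The factor brings \<open>t \<xi>\<close> into the range of both the mean inequality and the expansion.\<close>
  define t where "t = min r d / (norm \<xi> + 1) / 2"
  have np: "norm \<xi> + 1 > 0" by (simp add: add_nonneg_pos)
  have t: "t > 0" using r d np by (simp add: t_def)
  have cancel: "m / a / 2 * a = m / 2" if "a > 0" for m a :: real using that by simp
  have "t * norm \<xi> \<le> t * (norm \<xi> + 1)" using t by simp
  also have "\<dots> = min r d / 2" unfolding t_def by (rule cancel[OF np])
  also have "\<dots> < min r d" using r d(1) by (simp add: min_def)
  finally have tn: "t * norm \<xi> < min r d" .
  define \<eta> where "\<eta> = t *\<^sub>R \<xi>"
  have n\<eta>: "norm \<eta> < r" "norm \<eta> < d" using tn t by (auto simp: \<eta>_def)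
  let ?B = "W'' x"
  have sym: "?B a b = ?B b a" for a b by (rule has_hessian_on_symmetric[OF W]) simp
  define T where "T \<theta> = (W x + \<epsilon> * (norm \<eta>)\<^sup>2) + (p \<eta> * cos \<theta> + p (\<i> *s \<eta>) * sin \<theta>)
      + (?B \<eta> \<eta> * (cos \<theta>)\<^sup>2 + 2 * ?B \<eta> (\<i> *s \<eta>) * (sin \<theta> * cos \<theta>) + ?B (\<i> *s \<eta>) (\<i> *s \<eta>) * (sin \<theta>)\<^sup>2) / 2" for \<theta>
  have T: "(T has_integral (2 * pi * (W x + \<epsilon> * (norm \<eta>)\<^sup>2) + pi / 2 * (?B \<eta> \<eta> + ?B (\<i> *s \<eta>) (\<i> *s \<eta>)))) {0..2*pi}"
    unfolding T_def by (rule has_integral_second_order_circle)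
  have le: "W (x + cis \<theta> *s \<eta>) \<le> T \<theta>" for \<theta>
  proof -
    let ?h = "cis \<theta> *s \<eta>"
    have nh: "norm ?h = norm \<eta>" by (simp add: norm_smult_vec)
    have "W (x + ?h) \<le> W x + p ?h + ?B ?h ?h / 2 + \<epsilon> * (norm \<eta>)\<^sup>2"
      using d(2)[of ?h] n\<eta> nh by (simp add: abs_le_iff)
    also have "\<dots> = T \<theta>"
      unfolding T_def cis_smult
      by (simp add: blinfun.bilinear_simps power2_eq_square algebra_simps sym[of "\<i> *s \<eta>" \<eta>])
    finally show ?thesis .
  qed
  have cW: "continuous_on UNIV W"
    using W by (rule has_hessian_on_imp_continuous_on)
  have "(\<lambda>\<theta>. W (x + cis \<theta> *s \<eta>)) integrable_on {0..2*pi}"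
    by (intro integrable_continuous_real continuous_on_compose2[OF cW continuous_on_circle]) auto
  then have "integral {0..2*pi} (\<lambda>\<theta>. W (x + cis \<theta> *s \<eta>)) \<le> integral {0..2*pi} T"
    using T le by (intro integral_le) (auto simp: has_integral_integrable)
  also have "\<dots> = 2 * pi * (W x + \<epsilon> * (norm \<eta>)\<^sup>2 + levi ?B \<eta>)"
    using T by (simp add: integral_unique levi_def algebra_simps)
  finally have "circle_mean W x \<eta> \<le> W x + \<epsilon> * (norm \<eta>)\<^sup>2 + levi ?B \<eta>"
    unfolding circle_mean_def by (simp add: divide_simps mult.commute)
  with mean[OF n\<eta>(1)] have "c * (norm \<eta>)\<^sup>2 \<le> \<epsilon> * (norm \<eta>)\<^sup>2 + levi ?B \<eta>" by simp
  then have "t\<^sup>2 * (c * (norm \<xi>)\<^sup>2) \<le> t\<^sup>2 * (\<epsilon> * (norm \<xi>)\<^sup>2 + levi ?B \<xi>)"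
    unfolding \<eta>_def levi_scaleR by (simp add: power_mult_distrib algebra_simps)
  then have "c * (norm \<xi>)\<^sup>2 \<le> \<epsilon> * (norm \<xi>)\<^sup>2 + levi ?B \<xi>" using t by simp
  then show "c * (norm \<xi>)\<^sup>2 \<le> levi ?B \<xi> + e" using eps(2) by simp
qed

section \<open>Harmonic polynomials on the unit circle\<close>

text \<open>The mean value property of harmonic polynomials.\<close>

lemma Re_poly_mean:
  "((\<lambda>\<theta>. Re (poly p (cis \<theta>))) has_integral (2 * pi * Re (poly p 0))) {0..2 * pi}"
proof -
  have mono: "((\<lambda>\<theta>. Re (c * cis \<theta> ^ i)) has_integral (if i = 0 then 2 * pi * Re c else 0)) {0..2 * pi}"
    for c and i :: nat
  proof (cases "i = 0")
    case True
    then show ?thesis using has_integral_const_real[of "Re c" 0 "2 * pi"] by simp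
  next
    case False
    define F where "F \<theta> = (Re c * sin (i * \<theta>) + Im c * cos (i * \<theta>)) / i" for \<theta> :: real
    have "(F has_vector_derivative Re (c * cis \<theta> ^ i)) (at \<theta> within {0..2*pi})" for \<theta>
      unfolding F_def has_real_derivative_iff_has_vector_derivative[symmetric] Complex.DeMoivre
      using False by (auto intro!: derivative_eq_intros simp: field_simps)
    then have "((\<lambda>\<theta>. Re (c * cis \<theta> ^ i)) has_integral (F (2 * pi) - F 0)) {0..2 * pi}"
      by (intro fundamental_theorem_of_calculus) auto
    moreover have "F (2 * pi) = F 0"
      using sin_2npi[of i] cos_2npi[of i] by (simp add: F_def mult_ac)
    ultimately show ?thesis using False by simp
  qed
  have "((\<lambda>\<theta>. \<Sum>i\<le>degree p. Re (coeff p i * cis \<theta> ^ i)) has_integral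
      (\<Sum>i\<le>degree p. if i = 0 then 2 * pi * Re (coeff p i) else 0)) {0..2 * pi}"
    by (intro has_integral_sum mono) auto
  then show ?thesis by (simp add: poly_altdef[of p "cis _"] poly_0_coeff_0)
qed

definition harmonic_trace :: "(complex \<Rightarrow> real) \<Rightarrow> bool" where
  "harmonic_trace g \<longleftrightarrow> (\<exists>p. \<forall>z\<in>sphere 0 1. g z = Re (poly p z))"

lemma harmonic_trace_add:
  "harmonic_trace f \<Longrightarrow> harmonic_trace g \<Longrightarrow> harmonic_trace (\<lambda>z. f z + g z)"
  unfolding harmonic_trace_def by (metis poly_add plus_complex.sel(1))

lemma harmonic_trace_sum:
  assumes "finite I" "\<And>i. i \<in> I \<Longrightarrow> harmonic_trace (f i)"
  shows "harmonic_trace (\<lambda>z. \<Sum>i\<in>I. f i z)"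
  using assms
proof (induction I)
  case empty
  then show ?case by (auto simp: harmonic_trace_def intro!: exI[of _ 0])
next
  case (insert i I)
  then show ?case by (simp add: harmonic_trace_add)
qed

text \<open>On the unit circle the conjugate of \<open>z\<close> is \<open>1/z\<close>, so a mixed monomial is a power of \<open>z\<close> or of
  its conjugate; the latter has the same real part as a power of \<open>z\<close> with conjugated coefficient.\<close>

lemma harmonic_trace_mixed_monomial: "harmonic_trace (\<lambda>z. Re (a * z ^ i * cnj (z ^ j)))"
proof -
  have 1: "harmonic_trace (\<lambda>z. Re (a * z ^ i * cnj (z ^ j)))" if "j \<le> i" for a i j
    unfolding harmonic_trace_def
  proof (intro exI[of _ "monom a (i - j)"] ballI)
    fix z :: complex assume "z \<in> sphere 0 1"
    then have "z * cnj z = 1" using complex_norm_square[of z] by simp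
    then have u: "z ^ j * cnj (z ^ j) = 1" by (simp add: power_mult_distrib[symmetric])
    have "z ^ i = z ^ (i - j) * z ^ j" using that by (simp add: power_add[symmetric])
    then have "a * z ^ i * cnj (z ^ j) = a * z ^ (i - j) * (z ^ j * cnj (z ^ j))"
      by (simp only: mult.assoc)
    then show "Re (a * z ^ i * cnj (z ^ j)) = Re (poly (monom a (i - j)) z)"
      unfolding u by (simp only: poly_monom mult_1_right)
  qed
  show ?thesis
  proof (cases "j \<le> i")
    case False
    have "Re (a * z ^ i * cnj (z ^ j)) = Re (cnj a * z ^ j * cnj (z ^ i))" for z
    proof -
      have "Re (a * z ^ i * cnj (z ^ j)) = Re (cnj (a * z ^ i * cnj (z ^ j)))" by (rule cnj.sel(1)[symmetric])
      also have "cnj (a * z ^ i * cnj (z ^ j)) = cnj a * z ^ j * cnj (z ^ i)" by simp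
      finally show ?thesis .
    qed
    then show ?thesis using 1[of i j "cnj a"] False by simp
  qed (rule 1)
qed

text \<open>\<open>Re P Re Q = (Re (P Q) + Re (P cnj Q)) / 2\<close>, and the second summand consists of mixed monomials.\<close>

lemma harmonic_trace_mult:
  assumes "harmonic_trace f" "harmonic_trace g"
  shows "harmonic_trace (\<lambda>z. f z * g z)"
proof -
  obtain p q where p: "\<And>z. z \<in> sphere 0 1 \<Longrightarrow> f z = Re (poly p z)"
    and q: "\<And>z. z \<in> sphere 0 1 \<Longrightarrow> g z = Re (poly q z)"
    using assms unfolding harmonic_trace_def by metis
  have "harmonic_trace (\<lambda>z. \<Sum>i\<le>degree p. \<Sum>j\<le>degree q. Re (coeff p i * cnj (coeff q j) / 2 * z ^ i * cnj (z ^ j)))"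
    by (intro harmonic_trace_sum harmonic_trace_mixed_monomial) auto
  moreover have "(\<Sum>i\<le>degree p. \<Sum>j\<le>degree q. Re (coeff p i * cnj (coeff q j) / 2 * z ^ i * cnj (z ^ j)))
     = Re (poly p z * cnj (poly q z) / 2)" for z
  proof -
    have "poly p z * cnj (poly q z) / 2
      = (\<Sum>i\<le>degree p. \<Sum>j\<le>degree q. coeff p i * cnj (coeff q j) / 2 * z ^ i * cnj (z ^ j))"
      by (simp add: poly_altdef sum_product sum_divide_distrib mult_ac)
    then show ?thesis by (simp only: Re_sum)
  qed
  ultimately have 1: "harmonic_trace (\<lambda>z. Re (poly p z * cnj (poly q z) / 2))" by (simp only:)
  have 2: "harmonic_trace (\<lambda>z. Re (poly (smult (1 / 2) (p * q)) z))"
    unfolding harmonic_trace_def by blast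
  have "f z * g z = Re (poly p z * cnj (poly q z) / 2) + Re (poly (smult (1 / 2) (p * q)) z)"
    if "z \<in> sphere 0 1" for z
    using p[OF that] q[OF that] by (simp add: field_simps)
  with harmonic_trace_add[OF 1 2] show ?thesis unfolding harmonic_trace_def by (metis (no_types, lifting))
qed

text \<open>Every real polynomial on the plane agrees on the unit circle with a harmonic one. By the
  Stone-Weierstrass theorem the boundary values of harmonic polynomials are therefore dense among the
  continuous functions on the circle.\<close>

lemma real_polynomial_harmonic_trace:
  assumes "real_polynomial_function g"
  shows "harmonic_trace g"
  using assms
proof (induction rule: real_polynomial_function.induct)
  case (linear f)
  then interpret bounded_linear f .
  have "f z = Re (poly [:0, Complex (f 1) (- f \<i>):] z)" for z
  proof -
    have "f z = f (Re z *\<^sub>R 1 + Im z *\<^sub>R \<i>)" by (rule arg_cong[of _ _ f]) (simp add: complex_eq_iff)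
    also have "\<dots> = Re z * f 1 + Im z * f \<i>" by (simp only: add scaleR real_scaleR_def)
    finally show ?thesis by (simp add: algebra_simps)
  qed
  then show ?case unfolding harmonic_trace_def by blast
next
  case (const c)
  show ?case unfolding harmonic_trace_def by (intro exI[of _ "[:of_real c:]"]) simp
qed (simp_all add: harmonic_trace_add harmonic_trace_mult)

lemma harmonic_approximation_on_circle:
  assumes "continuous_on (sphere 0 1) g" "e > 0"
  obtains p where "\<And>z. z \<in> sphere 0 1 \<Longrightarrow> \<bar>g z - Re (poly p z)\<bar> < e"
proof -
  obtain h where h: "real_polynomial_function h" "\<And>z. z \<in> sphere 0 1 \<Longrightarrow> \<bar>g z - h z\<bar> < e"
    using Stone_Weierstrass_real_polynomial_function[OF compact_sphere assms] by blast
  then show ?thesis using that real_polynomial_harmonic_trace[OF h(1)]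
    unfolding harmonic_trace_def by metis
qed

section \<open>Circle mean inequality for continuous viscosity subsolutions\<close>

text \<open>On the compact set where \<open>\<Phi> \<ge> m\<close> the function \<open>g\<close> is bounded away from \<open>0\<close>, so a large multiple
  of it pushes \<open>\<Phi>\<close> below \<open>m\<close>.\<close>

lemma penalty_constant_exists:
  fixes \<Phi> g :: "'a::t2_space \<Rightarrow> real"
  assumes C: "compact C" and \<Phi>: "continuous_on C \<Phi>" and g: "continuous_on C g"
    and g0: "\<And>z. z \<in> C \<Longrightarrow> 0 \<le> g z"
    and zero: "\<And>z. z \<in> C \<Longrightarrow> g z = 0 \<Longrightarrow> \<Phi> z < m"
  obtains K where "\<And>z. z \<in> C \<Longrightarrow> \<Phi> z - K * g z < m"
proof (cases "\<exists>z\<in>C. m \<le> \<Phi> z")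
  case False
  then show ?thesis using that[of 0] by force
next
  case True
  define D where "D = {z \<in> C. m \<le> \<Phi> z}"
  have D: "D \<noteq> {}" "D \<subseteq> C" using True by (auto simp: D_def)
  have "closedin (top_of_set C) (C \<inter> \<Phi> -` {m..})"
    by (rule continuous_closedin_preimage[OF \<Phi> closed_atLeast])
  then have "compact (C \<inter> \<Phi> -` {m..})" by (rule closedin_compact[OF C])
  also have "C \<inter> \<Phi> -` {m..} = D" by (auto simp: D_def)
  finally have "compact D" .
  then obtain a where a: "a \<in> D" "\<And>z. z \<in> D \<Longrightarrow> g a \<le> g z"
    using continuous_attains_inf[OF _ D(1) continuous_on_subset[OF g D(2)]] by blast
  obtain b where b: "b \<in> C" "\<And>z. z \<in> C \<Longrightarrow> \<Phi> z \<le> \<Phi> b"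
    using continuous_attains_sup[OF C _ \<Phi>] True by blast
  have ga: "g a > 0" using zero[of a] g0[of a] a(1) D(2) by (force simp: D_def less_le)
  have M: "\<Phi> b \<ge> m" using a(1) b(2)[of a] by (auto simp: D_def)
  define K where "K = (\<Phi> b - m) / g a + 1"
  have K: "K > 0" "K * g a > \<Phi> b - m" using ga M by (auto simp: K_def field_simps intro: add_nonneg_pos)
  have "\<Phi> z - K * g z < m" if z: "z \<in> C" for z
  proof (cases "z \<in> D")
    case True
    have "K * g a \<le> K * g z" using a(2)[OF True] K(1) by simp
    then show ?thesis using K(2) b(2)[OF z] by linarith
  next
    case False
    moreover have "K * g z \<ge> 0" using K(1) g0[OF z] by simp
    ultimately show ?thesis using z by (simp add: D_def)
  qed
  then show ?thesis by (rule that)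
qed

text \<open>The viscosity form of \<open>\<Lambda>\<^sub>1(D\<^sup>2\<^sub>\<complex>w) \<ge> c\<close> at the points of \<open>S\<close>, stated through the Levi form
  of the test functions.\<close>

definition viscosity_levi_ge ::
    "(complex ^ 'n \<Rightarrow> real) \<Rightarrow> (complex ^ 'n) set \<Rightarrow> real \<Rightarrow> bool" where
  "viscosity_levi_ge w S c \<longleftrightarrow>
     (\<forall>x\<in>S. \<forall>U q q''. open U \<and> x \<in> U \<and> has_hessian_on U q q'' \<and> q x = w x \<and> (\<forall>z\<in>U. w z \<le> q z)
        \<longrightarrow> (\<forall>\<xi>. c * (norm \<xi>)\<^sup>2 \<le> levi (q'' x) \<xi>))"

lemma of_real_norm_vec_square:
  fixes \<eta> :: "complex ^ 'n"
  shows "of_real ((norm \<eta>)\<^sup>2) = (\<Sum>j\<in>UNIV. \<eta> $ j * cnj (\<eta> $ j))"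
proof -
  have "(norm \<eta>)\<^sup>2 = (\<Sum>j\<in>UNIV. (cmod (\<eta> $ j))\<^sup>2)"
    by (simp add: norm_vec_def L2_set_def sum_nonneg)
  then show ?thesis by (simp only: of_real_sum complex_norm_square)
qed

text \<open>Splits \<open>h\<close> into its component along the complex line through \<open>\<eta>\<close>, with complex coordinate
  \<open>l h\<close>, and a transversal part \<open>P h\<close>. Both maps are complex linear, hence the values at \<open>\<i> \<eta>\<close>.\<close>

lemma complex_line_coordinates:
  fixes \<eta> :: "complex ^ 'n"
  assumes "\<eta> \<noteq> 0"
  obtains l :: "(complex ^ 'n) \<Rightarrow>\<^sub>L complex" and P :: "(complex ^ 'n) \<Rightarrow>\<^sub>L (complex ^ 'n)"
  where "l \<eta> = 1" "l (\<i> *s \<eta>) = \<i>" "P \<eta> = 0" "P (\<i> *s \<eta>) = 0" "\<forall>h. h = l h *s \<eta> + P h"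
proof -
  define f where "f h = (\<Sum>j\<in>UNIV. h $ j * cnj (\<eta> $ j)) / of_real ((norm \<eta>)\<^sup>2)" for h
  have f1: "f \<eta> = 1" unfolding f_def using assms by (subst of_real_norm_vec_square[symmetric]) simp
  have "f (\<i> *s \<eta>) = \<i> * f \<eta>" by (simp add: f_def sum_distrib_left mult_ac)
  with f1 have f2: "f (\<i> *s \<eta>) = \<i>" by simp
  have lf: "linear f"
  proof (rule linearI)
    show "f (a + b) = f a + f b" for a b
      by (simp add: f_def distrib_right sum.distrib add_divide_distrib)
    have "(\<Sum>j\<in>UNIV. (r *\<^sub>R a) $ j * cnj (\<eta> $ j)) = r *\<^sub>R (\<Sum>j\<in>UNIV. a $ j * cnj (\<eta> $ j))" for r a
      by (simp add: scaleR_sum_right)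
    then show "f (r *\<^sub>R a) = r *\<^sub>R f a" for r a
      unfolding f_def by (simp only: divide_inverse mult_scaleR_left)
  qed
  then have bf: "bounded_linear f" by (simp add: linear_conv_bounded_linear)
  have "linear (\<lambda>h. h - f h *s \<eta>)"
    by (rule linearI) (auto simp: linear_add[OF lf] linear_cmul[OF lf] vec_eq_iff algebra_simps)
  then have bP: "bounded_linear (\<lambda>h. h - f h *s \<eta>)" by (simp add: linear_conv_bounded_linear)
  show ?thesis
    by (rule that[of "Blinfun f" "Blinfun (\<lambda>h. h - f h *s \<eta>)"]; (rule allI)?;
        simp add: bounded_linear_Blinfun_apply[OF bf] bounded_linear_Blinfun_apply[OF bP] f1 f2)
qed

text \<open>Let \<open>p\<close> be a polynomial whose real part approximates \<open>w\<close> on the circle within \<open>e/2\<close>. The function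
  \<open>H(\<zeta>) = Re p(\<zeta>) + e/2 + c |\<eta>|\<^sup>2 (|\<zeta>|\<^sup>2 - 1)\<close> lies above \<open>w\<close> on the circle, and
  \<open>w(z0) \<le> H(0)\<close> is the claim up to \<open>e\<close>, by the mean value property. If \<open>w(z0) > H(0)\<close>, then
  \<open>w - H \<circ> l - K |P|\<^sup>2\<close> with \<open>K\<close> large has an interior maximum in a neighbourhood of the disc in
  \<open>\<complex>\<^sup>n\<close>. There \<open>H \<circ> l + K |P|\<^sup>2\<close> plus a constant touches \<open>w\<close> from above; its Levi form in
  direction \<open>\<eta>\<close> does not see the penalty and equals \<open>c |\<eta>|\<^sup>2 < c0 |\<eta>|\<^sup>2\<close>.\<close>

lemma circle_mean_ge_of_viscosity:
  fixes w :: "complex ^ 'n \<Rightarrow> real"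
  assumes cont: "continuous_on (cball z0 \<rho>) w" and visc: "viscosity_levi_ge w (cball z0 \<rho>) c0"
    and c: "c < c0" and \<eta>: "norm \<eta> < \<rho>"
  shows "w z0 + c * (norm \<eta>)\<^sup>2 \<le> circle_mean w z0 \<eta>"
proof (cases "\<eta> = 0")
  case True
  then show ?thesis by (simp add: circle_mean_def)
next
  case False
  define \<kappa> where "\<kappa> = c * (norm \<eta>)\<^sup>2"
  obtain l :: "(complex ^ 'n) \<Rightarrow>\<^sub>L complex" and P :: "(complex ^ 'n) \<Rightarrow>\<^sub>L (complex ^ 'n)"
    where l: "l \<eta> = 1" "l (\<i> *s \<eta>) = \<i>" and P: "P \<eta> = 0" "P (\<i> *s \<eta>) = 0"
      and lP: "\<forall>h. h = l h *s \<eta> + P h"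
    by (rule complex_line_coordinates[OF False])
  have disc: "z0 + \<zeta> *s \<eta> \<in> cball z0 \<rho>" if "cmod \<zeta> \<le> 1" for \<zeta>
  proof -
    have "cmod \<zeta> * norm \<eta> \<le> 1 * norm \<eta>" using that by (rule mult_right_mono) simp
    then show ?thesis using \<eta> by (simp add: dist_norm norm_smult_vec)
  qed
  show ?thesis
  proof (rule field_le_epsilon)
    fix e :: real assume "e > 0"
    then have e: "e / 2 > 0" by simp
    have "continuous_on (sphere 0 1) (\<lambda>\<zeta>. w (z0 + \<zeta> *s \<eta>))"
      by (rule continuous_on_compose2[OF cont])
         (use disc in \<open>auto intro!: continuous_intros continuous_on_smult_vec\<close>)
    then obtain p where p: "\<And>\<zeta>. \<zeta> \<in> sphere 0 1 \<Longrightarrow> \<bar>w (z0 + \<zeta> *s \<eta>) - Re (poly p \<zeta>)\<bar> < e / 2"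
      using harmonic_approximation_on_circle[OF _ e] by blast
    define H where "H \<zeta> = Re (poly p \<zeta>) + e / 2 + \<kappa> * ((cmod \<zeta>)\<^sup>2 - 1)" for \<zeta>
    have main: "w z0 \<le> H 0"
    proof (rule ccontr)
      assume "\<not> w z0 \<le> H 0"
      define m where "m = w z0 - H 0"
      have m: "m > 0" using \<open>\<not> w z0 \<le> H 0\<close> by (simp add: m_def)
      define \<Phi> where "\<Phi> z = w z - H (l (z - z0))" for z
      define g where "g z = (norm (P (z - z0)))\<^sup>2" for z
      have cl: "continuous_on S (\<lambda>z. cmod (l (z - z0)))" for S by (intro continuous_intros)
      have c\<Phi>: "continuous_on (cball z0 \<rho>) \<Phi>"
        unfolding \<Phi>_def H_def by (intro continuous_intros cont) auto
      have cg: "continuous_on S g" for S unfolding g_def by (intro continuous_intros)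
      define T where "T = {z \<in> cball z0 \<rho>. cmod (l (z - z0)) \<le> 1}"
      \<comment> \<open>\<open>C\<close> plays the role of the boundary of \<open>T\<close>: the rest of \<open>T\<close> is the open set \<open>U\<close> below.\<close>
      define C where "C = {z \<in> T. cmod (l (z - z0)) = 1 \<or> dist z0 z = \<rho>}"
      have "closed {z. cmod (l (z - z0)) \<le> 1}" by (intro closed_Collect_le cl continuous_intros)
      then have "compact (cball z0 \<rho> \<inter> {z. cmod (l (z - z0)) \<le> 1})"
        by (rule compact_Int_closed[OF compact_cball])
      also have "cball z0 \<rho> \<inter> {z. cmod (l (z - z0)) \<le> 1} = T" by (auto simp: T_def)
      finally have T: "compact T" .
      have "closed {z. cmod (l (z - z0)) = 1 \<or> dist z0 z = \<rho>}"
        by (intro closed_Collect_disj closed_Collect_eq cl continuous_intros)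
      then have "compact (T \<inter> {z. cmod (l (z - z0)) = 1 \<or> dist z0 z = \<rho>})"
        by (rule compact_Int_closed[OF T])
      also have "T \<inter> {z. cmod (l (z - z0)) = 1 \<or> dist z0 z = \<rho>} = C" by (auto simp: C_def)
      finally have C: "compact C" .
      have sub: "T \<subseteq> cball z0 \<rho>" "C \<subseteq> T" by (auto simp: T_def C_def)
      obtain K where K: "\<And>z. z \<in> C \<Longrightarrow> \<Phi> z - K * g z < m"
      proof (rule penalty_constant_exists[OF C, of \<Phi> g m])
        show "continuous_on C \<Phi>" using c\<Phi> sub by (meson continuous_on_subset)
        fix z assume z: "z \<in> C" and "g z = 0"
        then have "P (z - z0) = 0" by (simp add: g_def)
        then have line: "z - z0 = l (z - z0) *s \<eta>" using lP by (metis add.right_neutral)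
        have le1: "cmod (l (z - z0)) \<le> 1" using z by (auto simp: C_def T_def)
        have "dist z0 z = cmod (l (z - z0)) * norm \<eta>"
          using line by (metis norm_smult_vec dist_norm dist_commute)
        also have "\<dots> \<le> 1 * norm \<eta>" using le1 by (rule mult_right_mono) simp
        finally have "dist z0 z < \<rho>" using \<eta> by simp
        then have one: "cmod (l (z - z0)) = 1" using z by (auto simp: C_def)
        have "z = z0 + l (z - z0) *s \<eta>" using line by (metis diff_add_cancel add.commute)
        then have "w z - Re (poly p (l (z - z0))) < e / 2"
          using p[of "l (z - z0)"] one by (metis abs_less_iff dist_0_norm mem_sphere)
        then show "\<Phi> z < m" using m one by (simp add: \<Phi>_def H_def)
      qed (use cg in \<open>auto simp: g_def\<close>)
      define F where "F z = \<Phi> z - K * g z" for z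
      have "0 \<le> \<rho>" using \<eta> norm_ge_zero[of \<eta>] by linarith
      then have z0T: "z0 \<in> T" by (simp add: T_def)
      have "continuous_on T F"
        unfolding F_def using c\<Phi> sub cg by (intro continuous_intros) (auto intro: continuous_on_subset)
      then obtain x where x: "x \<in> T" "\<And>z. z \<in> T \<Longrightarrow> F z \<le> F x"
        using continuous_attains_sup[OF T _ ] z0T by blast
      have "F z0 = m" by (simp add: F_def \<Phi>_def g_def m_def)
      then have "F x \<ge> m" using x(2)[OF z0T] by simp
      then have "x \<notin> C" using K[of x] by (auto simp: F_def)
      define U where "U = {z \<in> ball z0 \<rho>. cmod (l (z - z0)) < 1}"
      have "open {z. cmod (l (z - z0)) < 1}" by (intro open_Collect_less cl continuous_intros)
      then have "open (ball z0 \<rho> \<inter> {z. cmod (l (z - z0)) < 1})" by (rule open_Int[OF open_ball])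
      also have "ball z0 \<rho> \<inter> {z. cmod (l (z - z0)) < 1} = U" by (auto simp: U_def)
      finally have U: "open U" .
      have xU: "x \<in> U" using x(1) \<open>x \<notin> C\<close> by (auto simp: T_def C_def U_def)
      have UT: "U \<subseteq> T" by (auto simp: U_def T_def)
      obtain q1 where q1: "has_hessian_on U (\<lambda>z. Re (poly p (l (z - z0)))) q1"
        "\<And>z h k. q1 z h k = Re (poly (pderiv (pderiv p)) (l (z - z0)) * l h * l k)"
        using has_hessian_on_Re_poly_affine by metis
      obtain q2 where q2: "has_hessian_on U (\<lambda>z. (norm (l (z - z0)))\<^sup>2) q2"
        "\<And>z h k. q2 z h k = 2 * (l h \<bullet> l k)"
        using has_hessian_on_square_affine by metis
      obtain q3 where q3: "has_hessian_on U (\<lambda>z. (norm (P (z - z0)))\<^sup>2) q3"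
        "\<And>z h k. q3 z h k = 2 * (P h \<bullet> P k)"
        using has_hessian_on_square_affine by metis
      define q where "q z = Re (poly p (l (z - z0))) + (\<kappa> * (norm (l (z - z0)))\<^sup>2
        + (K * (norm (P (z - z0)))\<^sup>2 + (e / 2 - \<kappa> + F x)))" for z
      define q'' where "q'' z = q1 z + (\<kappa> *\<^sub>R q2 z + (K *\<^sub>R q3 z + 0))" for z
      have hq: "has_hessian_on U q q''"
        unfolding q_def q''_def
        by (intro has_hessian_on_add has_hessian_on_cmult has_hessian_on_const q1(1) q2(1) q3(1))
      \<comment> \<open>The constant in \<open>q\<close> is chosen such that \<open>q - w\<close> measures the distance of \<open>F\<close> from its maximum.\<close>
      have qF: "q z - w z = F x - F z" for z
        by (simp add: q_def F_def \<Phi>_def g_def H_def algebra_simps)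
      have "\<forall>z\<in>U. w z \<le> q z" using qF x(2) UT by (smt (verit) subsetD)
      moreover have "q x = w x" using qF[of x] by simp
      moreover have "x \<in> cball z0 \<rho>" using x(1) sub by blast
      ultimately have "c0 * (norm \<eta>)\<^sup>2 \<le> levi (q'' x) \<eta>"
        using visc[unfolded viscosity_levi_ge_def, rule_format, of x U q q''] U xU hq by blast
      also have "levi (q'' x) \<eta> = \<kappa>"
        by (simp add: levi_def q''_def blinfun.add_left blinfun.scaleR_left q1(2) q2(2) q3(2) l P)
      finally show False using c False by (simp add: \<kappa>_def)
    qed
    have int: "(\<lambda>\<theta>. w (z0 + cis \<theta> *s \<eta>)) integrable_on {0..2*pi}"
      using disc by (intro integrable_continuous_real continuous_on_compose2[OF cont continuous_on_circle]) auto
    have "2 * pi * Re (poly p 0) = integral {0..2*pi} (\<lambda>\<theta>. Re (poly p (cis \<theta>)))"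
      by (rule integral_unique[OF Re_poly_mean, symmetric])
    also have "\<dots> \<le> integral {0..2*pi} (\<lambda>\<theta>. w (z0 + cis \<theta> *s \<eta>) + e / 2)"
    proof (rule integral_le)
      show "(\<lambda>\<theta>. w (z0 + cis \<theta> *s \<eta>) + e / 2) integrable_on {0..2*pi}"
        by (intro integrable_add int integrable_const_ivl)
      show "Re (poly p (cis \<theta>)) \<le> w (z0 + cis \<theta> *s \<eta>) + e / 2" for \<theta>
        using p[of "cis \<theta>"] unfolding mem_sphere dist_0_norm norm_cis by linarith
    qed (use Re_poly_mean has_integral_integrable in blast)
    also have "\<dots> = 2 * pi * (circle_mean w z0 \<eta> + e / 2)"
      using int by (simp add: integral_add integrable_const_ivl circle_mean_def algebra_simps)
    finally have "Re (poly p 0) \<le> circle_mean w z0 \<eta> + e / 2" by simp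
    then show "w z0 + c * (norm \<eta>)\<^sup>2 \<le> circle_mean w z0 \<eta> + e"
      using main by (simp add: H_def \<kappa>_def)
  qed
qed

section \<open>Mollification\<close>

text \<open>Only the kernel is differentiated, so continuity of \<open>u\<close> suffices. The Leibniz rule is applied
  to the kernel and then to its derivative, as an integral of operator-valued functions.\<close>

lemma has_hessian_on_convolution:
  fixes k :: "'a::euclidean_space \<Rightarrow> real"
  assumes k: "has_hessian_on UNIV k k''" and u: "continuous_on (cbox a b) u"
  shows "\<exists>W''. has_hessian_on UNIV (\<lambda>x. integral (cbox a b) (\<lambda>y. u y * k (x - y))) W''"
proof -
  obtain k' where k'0: "\<forall>z\<in>UNIV. (k has_derivative blinfun_apply (k' z)) (at z)"
    "\<forall>z\<in>UNIV. (k' has_derivative blinfun_apply (k'' z)) (at z)"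
    by (rule has_hessian_onE[OF k])
  have k': "(k has_derivative blinfun_apply (k' z)) (at z)" "(k' has_derivative blinfun_apply (k'' z)) (at z)" for z using k'0 by auto
  have k'': "continuous_on UNIV k''" "\<And>z a b. k'' z a b = k'' z b a"
    using has_hessian_on_continuous[OF k] has_hessian_on_symmetric[OF k] by auto
  have ck: "continuous_on UNIV k" "continuous_on UNIV k'"
    using k' by (auto intro!: has_derivative_continuous_on)
  have prod: "continuous_on (UNIV \<times> cbox a b) (\<lambda>(x, y). u y *\<^sub>R g (x - y))"
    if "continuous_on UNIV g" for g :: "'a \<Rightarrow> 'c::real_normed_vector"
    unfolding split_beta
    by (intro continuous_on_scaleR continuous_on_compose2[OF u] continuous_on_compose2[OF that]
        continuous_intros) auto
  have int: "(\<lambda>y. u y *\<^sub>R g (x - y)) integrable_on cbox a b"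
    if "continuous_on UNIV g" for g :: "'a \<Rightarrow> 'c::banach" and x
    by (rule integrable_continuous)
       (intro continuous_on_scaleR u continuous_on_compose2[OF that] continuous_intros, auto)
  have shift: "((\<lambda>x. x - y) has_derivative (\<lambda>h. h)) (at x)" for x y :: 'a
    by (auto intro!: derivative_eq_intros)
  define W' where "W' x = integral (cbox a b) (\<lambda>y. u y *\<^sub>R k' (x - y))" for x
  define W'' where "W'' x = integral (cbox a b) (\<lambda>y. u y *\<^sub>R k'' (x - y))" for x
  have 1: "((\<lambda>x. integral (cbox a b) (\<lambda>y. u y *\<^sub>R k (x - y))) has_derivative W' x) (at x)" for x
    unfolding W'_def
  proof (rule leibniz_rule[where U = UNIV, simplified])
    fix x y
    show "((\<lambda>x. u y *\<^sub>R k (x - y)) has_derivative blinfun_apply (u y *\<^sub>R k' (x - y))) (at x)"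
      using has_derivative_mult_right[OF has_derivative_compose[OF shift[of y x] k'(1)[of "x - y"]], of "u y"]
      by (simp add: scaleR_blinfun.rep_eq)
  qed (use int[OF ck(1)] prod[OF ck(2)] in auto)
  have 2: "(W' has_derivative W'' x) (at x)" for x
    unfolding W'_def W''_def
  proof (rule leibniz_rule[where U = UNIV, simplified])
    fix x y
    show "((\<lambda>x. u y *\<^sub>R k' (x - y)) has_derivative blinfun_apply (u y *\<^sub>R k'' (x - y))) (at x)"
      using has_derivative_scaleR_right[OF has_derivative_compose[OF shift[of y x] k'(2)[of "x - y"]], of "u y"]
      by (simp add: scaleR_blinfun.rep_eq)
  qed (use int[OF ck(2)] prod[OF k''(1)] in auto)
  have 3: "continuous_on UNIV W''"
    unfolding W''_def using prod[OF k''(1)] by (rule integral_continuous_on_param)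
  have W''_apply: "W'' x h l = integral (cbox a b) (\<lambda>y. u y * k'' (x - y) h l)" for x h l
  proof -
    have "bounded_linear (\<lambda>B::'a \<Rightarrow>\<^sub>L 'a \<Rightarrow>\<^sub>L real. B h l)"
      by (rule bounded_linear_compose[OF blinfun.bounded_linear_left blinfun.bounded_linear_left])
    from integral_linear[OF int[OF k''(1)] this, of x]
    show ?thesis by (simp add: W''_def o_def blinfun.scaleR_left)
  qed
  show ?thesis
    by (rule exI[of _ W''], rule has_hessian_onI[where q' = W'])
       (use 1 2 3 in \<open>auto simp: W''_apply k''(2)\<close>)
qed

lemma positive_part_power_has_real_derivative:
  "((\<lambda>t::real. max 0 t ^ Suc (Suc n)) has_real_derivative of_nat (Suc (Suc n)) * max 0 t ^ Suc n) (at t)"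
proof (cases "t = 0")
  case True
  have "((\<lambda>h. (max 0 (0 + h) ^ Suc (Suc n) - max 0 (0::real) ^ Suc (Suc n)) / h) \<longlongrightarrow> 0) (at 0)"
  proof (rule Lim_null_comparison)
    show "\<forall>\<^sub>F h in at 0. norm ((max 0 (0 + h) ^ Suc (Suc n) - max 0 0 ^ Suc (Suc n)) / h) \<le> \<bar>h\<bar> ^ Suc n"
      by (rule always_eventually) (auto simp: max_def power_abs intro: mult_nonpos_nonneg)
    have "((\<lambda>h::real. \<bar>h\<bar> ^ Suc n) \<longlongrightarrow> \<bar>0\<bar> ^ Suc n) (at 0)"
      by (intro tendsto_intros)
    then show "((\<lambda>h::real. \<bar>h\<bar> ^ Suc n) \<longlongrightarrow> 0) (at 0)" by simp
  qed
  then show ?thesis using True by (simp add: DERIV_def)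
next
  case False
  show ?thesis
  proof (cases "t > 0")
    case True
    have "((\<lambda>t::real. t ^ Suc (Suc n)) has_real_derivative of_nat (Suc (Suc n)) * t ^ Suc n) (at t)"
      using DERIV_pow[of "Suc (Suc n)" t] by simp
    then have "((\<lambda>t::real. max 0 t ^ Suc (Suc n)) has_real_derivative of_nat (Suc (Suc n)) * t ^ Suc n) (at t)"
      by (rule has_field_derivative_transform_within_open[of _ _ _ "{0<..}"]) (use True in auto)
    then show ?thesis using True by simp
  next
    case neg: False
    have "((\<lambda>t::real. 0) has_real_derivative 0) (at t)" by simp
    then have "((\<lambda>t::real. max 0 t ^ Suc (Suc n)) has_real_derivative 0) (at t)"
      by (rule has_field_derivative_transform_within_open[of _ _ _ "{..<0}"]) (use False neg in auto)
    then show ?thesis using False neg by simp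
  qed
qed

text \<open>The third power of the positive part is the smallest integral one that is twice continuously
  differentiable.\<close>

lemma bump_has_hessian:
  fixes r :: real
  assumes r: "r \<noteq> 0"
  obtains q'' :: "'a::euclidean_space \<Rightarrow> 'a \<Rightarrow>\<^sub>L 'a \<Rightarrow>\<^sub>L real"
  where "has_hessian_on UNIV (\<lambda>x. max 0 (1 - (norm x)\<^sup>2 / r\<^sup>2) ^ 3) q''"
proof -
  define s where "s x = 1 - (norm x)\<^sup>2 / r\<^sup>2" for x :: 'a
  define m where "m x = max 0 (s x)" for x
  have s: "(s has_derivative (\<lambda>h. - (2 / r\<^sup>2) * (x \<bullet> h))) (at x)" for x
    unfolding s_def power2_norm_eq_inner divide_inverse[of _ "r\<^sup>2"] mult.commute[of _ "inverse (r\<^sup>2)"]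
    by (auto intro!: derivative_eq_intros simp: inner_commute)
  have pw: "((\<lambda>x. m x ^ Suc (Suc n)) has_derivative
      (\<lambda>h. of_nat (Suc (Suc n)) * m x ^ Suc n * (- (2 / r\<^sup>2) * (x \<bullet> h)))) (at x)" for n x
    using has_derivative_compose[OF s[of x]
        positive_part_power_has_real_derivative[of n "s x", unfolded has_field_derivative_def]]
    by (simp only: m_def)
  have 1: "((\<lambda>x. m x ^ 3) has_derivative (\<lambda>h. (- (6 / r\<^sup>2) * m x ^ 2) *\<^sub>R x \<bullet> h)) (at x)" for x
    using pw[where n = 1 and x = x] by (simp add: numeral_3_eq_3 numeral_2_eq_2 mult_ac)
  define D where "D x = (- (6 / r\<^sup>2) * m x ^ 2) *\<^sub>R id_blinfun
      + (24 / r ^ 4 * m x) *\<^sub>R (blinfun_scaleR_left x o\<^sub>L blinfun_inner_right x)" for x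
  have 2: "((\<lambda>x. (- (6 / r\<^sup>2) * m x ^ 2) *\<^sub>R x) has_derivative D x) (at x)" for x
  proof -
    have "((\<lambda>x. m x ^ 2) has_derivative (\<lambda>h. 2 * m x * (- (2 / r\<^sup>2) * (x \<bullet> h)))) (at x)"
      using pw[where n = 0 and x = x] by (simp add: numeral_2_eq_2)
    then have "((\<lambda>x. (- (6 / r\<^sup>2) * m x ^ 2) *\<^sub>R x) has_derivative
        (\<lambda>h. (- (6 / r\<^sup>2) * m x ^ 2) *\<^sub>R h + (- (6 / r\<^sup>2) * (2 * m x * (- (2 / r\<^sup>2) * (x \<bullet> h)))) *\<^sub>R x)) (at x)"
      by (intro has_derivative_scaleR has_derivative_mult_right has_derivative_ident)
    moreover have "(\<lambda>h. (- (6 / r\<^sup>2) * m x ^ 2) *\<^sub>R h + (- (6 / r\<^sup>2) * (2 * m x * (- (2 / r\<^sup>2) * (x \<bullet> h)))) *\<^sub>R x)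
        = blinfun_apply (D x)"
      by (rule ext) (simp add: D_def blinfun.add_left blinfun.diff_left blinfun.scaleR_left blinfun_scaleR_left.rep_eq
          blinfun_inner_right.rep_eq power4_eq_xxxx power2_eq_square mult_ac)
    ultimately show ?thesis by simp
  qed
  have cm: "continuous_on UNIV m" unfolding m_def s_def by (intro continuous_intros) (use r in auto)
  have 3: "continuous_on UNIV D"
    unfolding D_def
    by (intro continuous_intros cm bounded_bilinear.continuous_on[OF bounded_bilinear_blinfun_compose]
        bounded_linear.continuous_on[OF bounded_linear_blinfun_scaleR_left]
        bounded_linear.continuous_on[OF bounded_linear_blinfun_inner_right])
  obtain q'' where "has_hessian_on UNIV (\<lambda>z. m (id_blinfun (z - 0)) ^ 3) q''"
    by (rule has_hessian_on_compose_affine[OF 1 2 3, where A = id_blinfun and U = UNIV and a = 0])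
       (auto simp: D_def blinfun.add_left blinfun.diff_left blinfun.scaleR_left inner_simps inner_commute)
  then show ?thesis using that by (simp add: m_def s_def)
qed

lemma mollifier_exists:
  fixes r :: real
  assumes r: "r > 0"
  obtains k :: "'a::euclidean_space \<Rightarrow> real" and k''
  where "has_hessian_on UNIV k k''" "\<forall>x. k x \<ge> 0" "\<forall>x. norm x \<ge> r \<longrightarrow> k x = 0"
    "\<forall>x. k (- x) = k x" "(k has_integral 1) (cbox (- (r *\<^sub>R One)) (r *\<^sub>R One))"
proof -
  define b where "b x = max 0 (1 - (norm x)\<^sup>2 / r\<^sup>2) ^ 3" for x :: 'a
  obtain b'' where b'': "has_hessian_on UNIV b b''" unfolding b_def by (rule bump_has_hessian[of r]) (use r in auto)
  let ?C = "cbox (- (r *\<^sub>R One)) (r *\<^sub>R One) :: 'a set"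
  have cb: "continuous_on ?C b"
    by (rule continuous_on_subset[OF has_hessian_on_imp_continuous_on[OF b'']]) simp
  then have int: "b integrable_on ?C" by (rule integrable_continuous)
  define \<kappa> where "\<kappa> = integral ?C b"
  have "\<kappa> \<noteq> 0"
  proof
    assume "\<kappa> = 0"
    then have "(b has_integral 0) ?C" using int \<kappa>_def by (metis integrable_integral)
    then have "b 0 = 0"
      by (rule has_integral_0_cbox_imp_0[OF cb, rotated])
         (use r in \<open>auto simp: b_def box_ne_empty mem_box inner_Basis\<close>)
    then show False by (simp add: b_def)
  qed
  moreover have "\<kappa> \<ge> 0" unfolding \<kappa>_def by (rule integral_nonneg[OF int]) (simp add: b_def)
  ultimately have \<kappa>: "\<kappa> > 0" by simp
  show ?thesis
  proof (rule that)
    show "has_hessian_on UNIV (\<lambda>x. 1 / \<kappa> * b x) (\<lambda>x. (1 / \<kappa>) *\<^sub>R b'' x)"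
      by (rule has_hessian_on_cmult[OF b''])
    show "((\<lambda>x. 1 / \<kappa> * b x) has_integral 1) ?C"
      using has_integral_mult_right[OF integrable_integral[OF int], of "1 / \<kappa>"] \<kappa> by (simp add: \<kappa>_def)
    have "b x = 0" if "r \<le> norm x" for x
    proof -
      have "r\<^sup>2 \<le> (norm x)\<^sup>2" using that r by simp
      then show ?thesis using r by (simp add: b_def)
    qed
    then show "\<forall>x. r \<le> norm x \<longrightarrow> 1 / \<kappa> * b x = 0" by simp
  qed (use \<kappa> in \<open>auto simp: b_def\<close>)
qed

lemma norm_less_imp_mem_cube: "norm x < r \<Longrightarrow> x \<in> cbox (- (r *\<^sub>R One)) (r *\<^sub>R One)"
  for x :: "'a::euclidean_space"
  using Basis_le_norm[of _ x] by (fastforce simp: mem_box abs_le_iff)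

text \<open>The approximation is the convolution \<open>W(x) = \<integral> w(x + y) k(y) dy\<close> with an even mollifier \<open>k\<close>
  supported in the ball of radius \<open>r\<close>. Written as \<open>\<integral> w(y) k(x - y) dy\<close> over a fixed box it is
  smooth; the box is chosen so large that the two expressions agree for \<open>x\<close> in the bounded set \<open>V\<close>. The last property transfers the circle mean inequality from \<open>w\<close> to \<open>W\<close> by Fubini
  and then translates it into a bound for the Levi form.\<close>

lemma smooth_approximation:
  fixes w :: "complex ^ 'n \<Rightarrow> real"
  assumes w: "continuous_on UNIV w" and V: "bounded V" and r: "r > 0"
  obtains W W'' where "has_hessian_on UNIV W W''"
    "\<forall>x\<in>V. \<forall>C. (\<forall>y. norm y \<le> r \<longrightarrow> w (x + y) \<le> C) \<longrightarrow> W x \<le> C"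
    "\<forall>x\<in>V. \<forall>C. (\<forall>y. norm y \<le> r \<longrightarrow> C \<le> w (x + y)) \<longrightarrow> C \<le> W x"
    "\<forall>x c \<rho>. \<rho> > 0 \<longrightarrow> cball x \<rho> \<subseteq> V \<longrightarrow>
       (\<forall>y \<eta>. norm y \<le> r \<longrightarrow> norm \<eta> < \<rho> \<longrightarrow> w (x + y) + c * (norm \<eta>)\<^sup>2 \<le> circle_mean w (x + y) \<eta>)
       \<longrightarrow> (\<forall>\<xi>. c * (norm \<xi>)\<^sup>2 \<le> levi (W'' x) \<xi>)"
proof -
  obtain k :: "complex ^ 'n \<Rightarrow> real" and k''
    where k: "has_hessian_on UNIV k k''" "\<forall>x. k x \<ge> 0" "\<forall>x. norm x \<ge> r \<longrightarrow> k x = 0"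
    "\<forall>x. k (- x) = k x" "(k has_integral 1) (cbox (- (r *\<^sub>R One)) (r *\<^sub>R One))"
    by (rule mollifier_exists[OF r])
  have ck: "continuous_on UNIV k" by (rule has_hessian_on_imp_continuous_on[OF k(1)])
  obtain M where M: "\<And>x. x \<in> V \<Longrightarrow> norm x \<le> M" using V unfolding bounded_iff by blast
  define B :: "(complex ^ 'n) set" where "B = cbox (- ((M + r + 1) *\<^sub>R One)) ((M + r + 1) *\<^sub>R One)"
  let ?C = "cbox (- (r *\<^sub>R One)) (r *\<^sub>R One) :: (complex ^ 'n) set"
  define W where "W x = integral B (\<lambda>y. w y * k (x - y))" for x
  obtain W'' where W'': "has_hessian_on UNIV W W''"
    unfolding W_def[abs_def] B_def
    using has_hessian_on_convolution[OF k(1) continuous_on_subset[OF w]] by blast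
  have ci: "(\<lambda>y. w (x + y) * k y) integrable_on ?C" for x
    by (intro integrable_continuous continuous_on_mult continuous_on_subset[OF ck]
        continuous_on_compose2[OF w] continuous_intros) auto
  have Wx: "W x = integral ?C (\<lambda>y. w (x + y) * k y)" if x: "x \<in> V" for x
  proof -
    define f where "f y = w y * k (x - y)" for y
    have sp: "y \<in> B \<and> y - x \<in> ?C" if "f y \<noteq> 0" for y
    proof -
      have "norm (x - y) < r" using that k(3) unfolding f_def by (metis mult_zero_right not_le)
      then have n: "norm (y - x) < r" by (simp add: norm_minus_commute)
      have "norm y \<le> norm x + norm (y - x)" by (metis add.commute diff_add_cancel norm_triangle_ineq)
      then have "norm y < M + r + 1" using n M[OF x] by simp
      then show ?thesis unfolding B_def using norm_less_imp_mem_cube n by blast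
    qed
    have "((\<lambda>y. f (y + x)) has_integral integral ?C (\<lambda>y. w (x + y) * k y)) ?C"
      using integrable_integral[OF ci[of x]] by (simp add: f_def k(4) add.commute)
    from has_integral_shift_cbox[OF this, of "- x"]
    have "(f has_integral integral ?C (\<lambda>y. w (x + y) * k y)) (cbox (- (r *\<^sub>R One) + x) (r *\<^sub>R One + x))"
      by simp
    then have "(f has_integral integral ?C (\<lambda>y. w (x + y) * k y)) UNIV"
    proof (rule has_integral_on_superset)
      fix y assume "y \<notin> cbox (- (r *\<^sub>R One) + x) (r *\<^sub>R One + x)"
      then have "y - x \<notin> ?C" by (auto simp: mem_box algebra_simps)
      then show "f y = 0" using sp by blast
    qed simp
    then have "((\<lambda>y. if y \<in> B then f y else 0) has_integral integral ?C (\<lambda>y. w (x + y) * k y)) UNIV"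
      by (rule has_integral_eq[rotated]) (use sp in auto)
    then have "(f has_integral integral ?C (\<lambda>y. w (x + y) * k y)) B"
      by (simp only: has_integral_restrict_UNIV)
    then show ?thesis unfolding W_def f_def by (rule integral_unique)
  qed
  have kint: "((\<lambda>y. C * k y) has_integral C) ?C" for C
    using has_integral_mult_right[OF k(5), of C] by simp
  have le: "f y * k y \<le> g y * k y" if "norm y \<le> r \<Longrightarrow> f y \<le> g y" for f g y
    using that k(2,3) by (cases "norm y \<le> r") (auto intro: mult_right_mono)
  show ?thesis
  proof (rule that[OF W'']; intro ballI allI impI)
    fix x C assume x: "x \<in> V" and C: "\<forall>y. norm y \<le> r \<longrightarrow> w (x + y) \<le> C"
    show "W x \<le> C"
      unfolding Wx[OF x]
      by (rule has_integral_le[OF integrable_integral[OF ci] kint]) (rule le, use C in blast)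
  next
    fix x C assume x: "x \<in> V" and C: "\<forall>y. norm y \<le> r \<longrightarrow> C \<le> w (x + y)"
    show "C \<le> W x"
      unfolding Wx[OF x]
      by (rule has_integral_le[OF kint integrable_integral[OF ci]]) (rule le, use C in blast)
  next
    fix x \<xi> :: "complex ^ 'n" and c \<rho> :: real
    assume \<rho>: "\<rho> > 0" and V: "cball x \<rho> \<subseteq> V"
      and mean: "\<forall>y \<eta>. norm y \<le> r \<longrightarrow> norm \<eta> < \<rho> \<longrightarrow> w (x + y) + c * (norm \<eta>)\<^sup>2 \<le> circle_mean w (x + y) \<eta>"
    show "c * (norm \<xi>)\<^sup>2 \<le> levi (W'' x) \<xi>"
    proof (rule levi_ge_of_circle_mean_ge[OF W'' \<rho>])
      fix \<eta> :: "complex ^ 'n" assume \<eta>: "norm \<eta> < \<rho>"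
      have xV: "x \<in> V" using V \<rho> by auto
      have cV: "x + cis \<theta> *s \<eta> \<in> V" for \<theta>
        using V \<eta> by (auto simp: dist_norm norm_smult_vec)
      have cont2: "continuous_on (S \<times> T) (\<lambda>(\<theta>, y). w (x + cis \<theta> *s \<eta> + y) * k y)" for S T
        unfolding split_beta
        by (intro continuous_on_mult continuous_on_compose2[OF w] continuous_on_compose2[OF ck]
            continuous_intros continuous_on_smult_vec continuous_on_compose2[OF continuous_on_cis[OF continuous_on_id]])
          auto
      have "2 * pi * circle_mean W x \<eta> = integral (cbox 0 (2 * pi)) (\<lambda>\<theta>. integral ?C (\<lambda>y. w (x + cis \<theta> *s \<eta> + y) * k y))"
        by (simp add: circle_mean_def Wx[OF cV])
      also have "\<dots> = integral ?C (\<lambda>y. integral (cbox 0 (2 * pi)) (\<lambda>\<theta>. w (x + cis \<theta> *s \<eta> + y) * k y))"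
        by (rule integral_swap_continuous) (simp only: cbox_Pair_eq cont2)
      also have "\<dots> = integral ?C (\<lambda>y. 2 * pi * (circle_mean w (x + y) \<eta> * k y))"
        by (simp add: circle_mean_def add.assoc add.commute[of "cis _ *s \<eta>"])
      finally have eq: "2 * pi * circle_mean W x \<eta> = integral ?C (\<lambda>y. 2 * pi * (circle_mean w (x + y) \<eta> * k y))" .
      have "continuous_on ?C (\<lambda>y. integral (cbox 0 (2 * pi)) (\<lambda>\<theta>. w (x + cis \<theta> *s \<eta> + y) * k y))"
        using continuous_on_swap_args[OF cont2] by (intro integral_continuous_on_param) simp
      then have "continuous_on ?C (\<lambda>y. 2 * pi * (circle_mean w (x + y) \<eta> * k y))"
        by (simp add: circle_mean_def add.assoc add.commute[of "cis _ *s \<eta>"])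
      then have int: "(\<lambda>y. 2 * pi * (circle_mean w (x + y) \<eta> * k y)) integrable_on ?C"
        by (rule integrable_continuous)
      have lhs: "((\<lambda>y. 2 * pi * (w (x + y) * k y + c * (norm \<eta>)\<^sup>2 * k y)) has_integral
          2 * pi * (W x + c * (norm \<eta>)\<^sup>2)) ?C"
        unfolding Wx[OF xV]
        by (intro has_integral_mult_right has_integral_add integrable_integral ci kint)
      have "2 * pi * (W x + c * (norm \<eta>)\<^sup>2) \<le> 2 * pi * circle_mean W x \<eta>"
        unfolding eq
      proof (rule has_integral_le[OF lhs integrable_integral[OF int]])
        fix y
        have "(w (x + y) + c * (norm \<eta>)\<^sup>2) * k y \<le> circle_mean w (x + y) \<eta> * k y"
          by (rule le) (use mean \<eta> in blast)
        then show "2 * pi * (w (x + y) * k y + c * (norm \<eta>)\<^sup>2 * k y) \<le> 2 * pi * (circle_mean w (x + y) \<eta> * k y)"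
          by (intro mult_left_mono) (auto simp: algebra_simps)
      qed
      then show "W x + c * (norm \<eta>)\<^sup>2 \<le> circle_mean W x \<eta>" by simp
    qed
  qed
qed

section \<open>Semicontinuity and sup-convolution\<close>

lemma usc_onD:
  fixes g :: "'a::metric_space \<Rightarrow> 'b::linorder"
  assumes "usc_on S g" "x \<in> S" "g x < c"
  shows "\<exists>d>0. \<forall>y\<in>S. dist y x < d \<longrightarrow> g y < c"
proof -
  have "\<forall>\<^sub>F y in at x within S. g y < c" using assms by (simp add: usc_on_def)
  then obtain d where d: "d > 0" "\<forall>y\<in>S. y \<noteq> x \<and> dist y x < d \<longrightarrow> g y < c"
    unfolding eventually_at by blast
  have "g y < c" if "y \<in> S" "dist y x < d" for y
    using d(2) that assms(3) by (cases "y = x") auto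
  then show ?thesis using d(1) by blast
qed

lemma usc_on_uminus: "lsc_on S g \<Longrightarrow> usc_on S (\<lambda>x. - g x :: real)"
  unfolding usc_on_def lsc_on_def by (simp add: minus_less_iff)

lemma usc_on_add_continuous:
  fixes g h :: "'a::metric_space \<Rightarrow> real"
  assumes g: "usc_on S g" and h: "continuous_on S h"
  shows "usc_on S (\<lambda>x. g x + h x)"
  unfolding usc_on_def
proof (intro ballI allI impI)
  fix x c assume x: "x \<in> S" and c: "g x + h x < c"
  define d where "d = (c - g x - h x) / 2"
  have d: "g x < g x + d" "h x < h x + d" using c by (auto simp: d_def)
  have "\<forall>\<^sub>F y in at x within S. g y < g x + d" using g x d(1) unfolding usc_on_def by blast
  moreover have "\<forall>\<^sub>F y in at x within S. h y < h x + d"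
    using h x d(2) unfolding continuous_on_def by (metis order_tendstoD(2))
  ultimately show "\<forall>\<^sub>F y in at x within S. g y + h y < c"
    by eventually_elim (simp add: d_def field_simps)
qed

text \<open>If no point were maximal, every point would have a neighbourhood on which \<open>g\<close> stays below a value
  \<open>g (y x)\<close>; for the largest of these values in a finite subcover this is contradictory.\<close>

lemma usc_on_attains_sup:
  fixes g :: "'a::metric_space \<Rightarrow> real"
  assumes S: "compact S" "S \<noteq> {}" and g: "usc_on S g"
  obtains x where "x \<in> S" "\<forall>y\<in>S. g y \<le> g x"
proof (rule ccontr)
  assume "\<not> thesis"
  then have "\<forall>x\<in>S. \<exists>y\<in>S. g x < g y" using that by (meson not_le)
  then obtain y where "\<forall>x\<in>S. y x \<in> S \<and> g x < g (y x)" unfolding bchoice_iff Bex_def by blast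
  then have y: "y x \<in> S \<and> g x < g (y x)" if "x \<in> S" for x using that by blast
  have "\<forall>x\<in>S. \<exists>d>0. \<forall>z\<in>S. dist z x < d \<longrightarrow> g z < g (y x)"
    using usc_onD[OF g] y by blast
  then obtain d where "\<forall>x\<in>S. d x > 0 \<and> (\<forall>z\<in>S. dist z x < d x \<longrightarrow> g z < g (y x))"
    unfolding bchoice_iff by blast
  then have d: "d x > 0 \<and> (\<forall>z\<in>S. dist z x < d x \<longrightarrow> g z < g (y x))" if "x \<in> S" for x
    using that by blast
  have "S \<subseteq> (\<Union>x\<in>S. ball x (d x))" using d by fastforce
  then obtain F where F: "F \<subseteq> S" "finite F" "S \<subseteq> (\<Union>x\<in>F. ball x (d x))"
    using compactE_image[OF S(1), of S "\<lambda>x. ball x (d x)"] by auto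
  have "F \<noteq> {}" using F(3) S(2) by auto
  then obtain x where x: "x \<in> F" and xmax: "Max ((\<lambda>x. g (y x)) ` F) = g (y x)"
    using obtains_MAX[OF F(2)] by blast
  have x2: "g (y x') \<le> g (y x)" if "x' \<in> F" for x'
    unfolding xmax[symmetric] using F(2) that by simp
  have yx: "y x \<in> S" using y x F(1) by blast
  then obtain x' where "x' \<in> F" "y x \<in> ball x' (d x')" using F(3) by blast
  then have "g (y x) < g (y x')" using d[of x'] F(1) yx by (auto simp: dist_commute)
  with x2[OF \<open>x' \<in> F\<close>] show False by simp
qed

text \<open>A supremum of \<open>L\<close>-Lipschitz functions is \<open>L\<close>-Lipschitz, and semicontinuity on a compact set lets
  the supremum be attained, at a point \<open>Y x\<close>.\<close>

lemma Lipschitz_sup_convolution: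
  fixes u :: "'a::metric_space \<Rightarrow> real"
  assumes K: "compact K" "K \<noteq> {}" and u: "usc_on K u" and L: "L \<ge> 0"
  obtains w Y where "\<forall>x. Y x \<in> K" "\<forall>x. w x = u (Y x) - L * dist x (Y x)"
    "\<forall>x. \<forall>y\<in>K. u y - L * dist x y \<le> w x"
    "\<forall>x x'. w x \<le> w x' + L * dist x x'"
proof -
  have "\<exists>y\<in>K. \<forall>z\<in>K. u z + - L * dist x z \<le> u y + - L * dist x y" for x
  proof -
    have "usc_on K (\<lambda>y. u y + - L * dist x y)"
      by (intro usc_on_add_continuous u continuous_intros)
    from usc_on_attains_sup[OF K this] show ?thesis by metis
  qed
  then obtain Y where Y: "\<And>x. Y x \<in> K" "\<And>x z. z \<in> K \<Longrightarrow> u z - L * dist x z \<le> u (Y x) - L * dist x (Y x)"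
    by (metis (no_types, lifting) add_uminus_conv_diff mult_minus_left)
  show ?thesis
  proof (rule that[of Y "\<lambda>x. u (Y x) - L * dist x (Y x)"]; intro ballI allI)
    fix x x'
    have "dist x' (Y x) \<le> dist x x' + dist x (Y x)" by (metis dist_commute dist_triangle)
    then have "L * dist x' (Y x) \<le> L * dist x x' + L * dist x (Y x)"
      using L by (metis mult_left_mono distrib_left)
    with Y(2)[OF Y(1), of x x']
    show "u (Y x) - L * dist x (Y x) \<le> u (Y x') - L * dist x' (Y x') + L * dist x x'" by linarith
  qed (use Y in auto)
qed

text \<open>If \<open>q\<close> touches \<open>w\<close> from above at \<open>x\<close>, then \<open>q\<close> translated by \<open>x - Y x\<close> and raised by the constant
  \<open>L |x - Y x|\<close> touches \<open>u\<close> from above at \<open>Y x\<close>. The translation keeps the distance between the two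
  arguments fixed, so the cone contributes only this constant.\<close>

lemma viscosity_levi_ge_sup_convolution:
  fixes u w :: "complex ^ 'n \<Rightarrow> real"
  assumes \<Omega>: "open \<Omega>" and sub: "viscosity_subsolution \<Omega> f (\<lambda>z. ereal (u z))"
    and Y: "\<And>x. x \<in> S \<Longrightarrow> Y x \<in> \<Omega> \<and> c \<le> f (Y x) \<and> w x = u (Y x) - L * dist x (Y x)"
    and w: "\<And>x y. y \<in> \<Omega> \<Longrightarrow> u y - L * dist x y \<le> w x"
  shows "viscosity_levi_ge w S c"
  unfolding viscosity_levi_ge_def
proof (intro ballI allI impI, elim conjE)
  fix x \<xi> :: "complex ^ 'n" and U q q''
  assume x: "x \<in> S" and U: "open U" "x \<in> U" and q: "has_hessian_on U q q''"
    and qx: "q x = w x" and qU: "\<forall>z\<in>U. w z \<le> q z"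
  define a where "a = x - Y x"
  define U' where "U' = {z. z + a \<in> U}"
  define p where "p z = q (z + a) + L * dist x (Y x)" for z
  have hp: "has_hessian_on U' p (\<lambda>z. q'' (z + a) + 0)"
    unfolding U'_def p_def
    by (rule has_hessian_on_add[OF has_hessian_on_translate[OF q] has_hessian_on_const])
  have U': "open U'"
  proof -
    have "open ((\<lambda>z. z + a) -` U)" by (rule open_vimage[OF U(1)]) (intro continuous_intros)
    then show ?thesis by (simp add: U'_def vimage_def)
  qed
  have YU: "Y x \<in> U'" using U(2) by (simp add: U'_def a_def)
  have "touches_above p (\<lambda>z. ereal (u z)) (Y x)"
    unfolding touches_above_def
  proof
    show "ereal (p (Y x)) = ereal (u (Y x))" using Y[OF x] qx by (simp add: p_def a_def)
    have "u z \<le> p z" if "z \<in> U' \<inter> \<Omega>" for z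
    proof -
      have "dist (z + a) z = dist x (Y x)" by (simp add: a_def dist_norm)
      then have "u z - L * dist x (Y x) \<le> w (z + a)" using w[of z "z + a"] that by simp
      also have "\<dots> \<le> q (z + a)" using qU that by (simp add: U'_def)
      finally show ?thesis by (simp add: p_def)
    qed
    moreover have "\<forall>\<^sub>F z in nhds (Y x). z \<in> U' \<inter> \<Omega>"
      using Y[OF x] YU U' \<Omega> by (intro eventually_nhds_in_open) auto
    ultimately show "\<forall>\<^sub>F z in nhds (Y x). ereal (u z) \<le> ereal (p z)"
      by (auto elim: eventually_mono)
  qed
  moreover have "C2_near (Y x) p" by (rule C2_near_has_hessian[OF hp U' YU])
  ultimately have "f (Y x) \<le> smallest_eigenvalue (complex_hessian p (Y x))"
    using sub Y[OF x] unfolding viscosity_subsolution_def by blast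
  then have "c \<le> smallest_eigenvalue (complex_hessian p (Y x))" using Y[OF x] by simp
  then have "c * (norm \<xi>)\<^sup>2 \<le> smallest_eigenvalue (complex_hessian p (Y x)) * (norm \<xi>)\<^sup>2"
    by (rule mult_right_mono) simp
  also have "\<dots> \<le> levi (q'' (Y x + a) + 0) \<xi>" by (rule smallest_eigenvalue_le_levi[OF hp U' YU])
  finally show "c * (norm \<xi>)\<^sup>2 \<le> levi (q'' x) \<xi>" by (simp add: a_def)
qed

section \<open>Comparison\<close>

text \<open>At a point \<open>p\<close> of \<open>F\<close>, semicontinuity gives \<open>u < u p + e/2\<close> and \<open>v > v p - e/2\<close> nearby; a Lebesgue
  number for these neighbourhoods makes the radius uniform.\<close>

lemma ordered_on_compact_imp_uniformly_nearly_ordered: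
  fixes u v :: "'a::metric_space \<Rightarrow> real"
  assumes u: "usc_on K u" and v: "lsc_on K v" and F: "compact F" "F \<subseteq> K"
    and le: "\<And>p. p \<in> F \<Longrightarrow> u p \<le> v p" and e: "e > 0"
  obtains \<rho> where "\<rho> > 0"
    "\<forall>p\<in>F. \<forall>x\<in>K. \<forall>y\<in>K. dist p x < \<rho> \<longrightarrow> dist p y < \<rho> \<longrightarrow> u y < v x + e"
proof -
  have "\<exists>d>0. \<forall>x\<in>K. dist x p < d \<longrightarrow> u x < u p + e / 2 \<and> v p - e / 2 < v x" if p: "p \<in> F" for p
  proof -
    obtain d1 where d1: "d1 > 0" "\<forall>x\<in>K. dist x p < d1 \<longrightarrow> u x < u p + e / 2"
      using usc_onD[OF u, of p "u p + e / 2"] p F(2) e by auto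
    obtain d2 where d2: "d2 > 0" "\<forall>x\<in>K. dist x p < d2 \<longrightarrow> - v x < - v p + e / 2"
      using usc_onD[OF usc_on_uminus[OF v], of p "- v p + e / 2"] p F(2) e by auto
    show ?thesis using d1 d2 by (intro exI[of _ "min d1 d2"]) auto
  qed
  then obtain d where d: "\<And>p. p \<in> F \<Longrightarrow> d p > 0"
    "\<And>p x. p \<in> F \<Longrightarrow> x \<in> K \<Longrightarrow> dist x p < d p \<Longrightarrow> u x < u p + e / 2 \<and> v p - e / 2 < v x"
    by metis
  have "F \<subseteq> \<Union> ((\<lambda>p. ball p (d p)) ` F)" using d(1) by fastforce
  then obtain \<rho> where \<rho>: "\<rho> > 0" "\<And>p. p \<in> F \<Longrightarrow> \<exists>G\<in>(\<lambda>p. ball p (d p)) ` F. ball p \<rho> \<subseteq> G"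
    using Heine_Borel_lemma[OF F(1), of "(\<lambda>p. ball p (d p)) ` F"] by (metis (no_types, lifting) imageE open_ball)
  show ?thesis
  proof (rule that[OF \<rho>(1)]; intro ballI impI)
    fix p x y assume p: "p \<in> F" and xy: "x \<in> K" "y \<in> K" "dist p x < \<rho>" "dist p y < \<rho>"
    obtain p' where p': "p' \<in> F" "ball p \<rho> \<subseteq> ball p' (d p')" using \<rho>(2)[OF p] by blast
    then have "x \<in> ball p' (d p')" "y \<in> ball p' (d p')" using xy by (auto simp: subset_iff)
    then have "u y < u p' + e / 2" "v p' - e / 2 < v x"
      using d(2)[OF p'(1)] xy by (auto simp: dist_commute)
    then show "u y < v x + e" using le[OF p'(1)] by simp
  qed
qed

text \<open>Adding a constant to \<open>q\<close> turns it into a test function touching \<open>v\<close> from below at \<open>x0\<close>.\<close>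

lemma supersolution_not_touched_below:
  fixes v q :: "complex ^ 'n \<Rightarrow> real"
  assumes sup: "viscosity_supersolution \<Omega> f (\<lambda>z. ereal (v z))"
    and \<Omega>: "open \<Omega>" "x0 \<in> \<Omega>" and q: "has_hessian_on \<Omega> q q''"
    and c: "f x0 < c" "\<And>\<xi>. c * (norm \<xi>)\<^sup>2 \<le> levi (q'' x0) \<xi>"
    and min: "\<And>x. x \<in> \<Omega> \<Longrightarrow> v x0 - q x0 \<le> v x - q x"
  shows False
proof -
  define p where "p z = q z + (v x0 - q x0)" for z
  have hp: "has_hessian_on \<Omega> p (\<lambda>z. q'' z + 0)"
    unfolding p_def by (rule has_hessian_on_add[OF q has_hessian_on_const])
  have ev: "\<forall>\<^sub>F z in nhds x0. z \<in> \<Omega>" using \<Omega> by (rule eventually_nhds_in_open)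
  have "touches_below p (\<lambda>z. ereal (v z)) x0"
    unfolding touches_below_def
  proof
    show "\<forall>\<^sub>F z in nhds x0. ereal (p z) \<le> ereal (v z)"
      using ev by (rule eventually_mono) (use min in \<open>fastforce simp: p_def\<close>)
  qed (simp add: p_def)
  moreover have "C2_near x0 p" by (rule C2_near_has_hessian[OF hp \<Omega>])
  ultimately have "max (smallest_eigenvalue (complex_hessian p x0)) 0 \<le> f x0"
    using sup \<Omega>(2) unfolding viscosity_supersolution_def by blast
  moreover have "c \<le> smallest_eigenvalue (complex_hessian p x0)"
    by (rule smallest_eigenvalue_ge_levi[OF hp \<Omega>]) (simp add: c(2))
  ultimately show False using c(1) by simp
qed

lemma ball_subset_if_disjoint_frontier:
  fixes \<Omega> :: "'a::real_normed_vector set"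
  assumes \<Omega>: "open \<Omega>" and x: "x \<in> closure \<Omega>" and far: "\<And>p. p \<in> frontier \<Omega> \<Longrightarrow> r \<le> dist p x" and r: "r > 0"
  shows "ball x r \<subseteq> \<Omega>"
proof (rule ccontr)
  assume "\<not> ball x r \<subseteq> \<Omega>"
  then have "ball x r - \<Omega> \<noteq> {}" by auto
  moreover have "x \<in> \<Omega>" using x far[of x] r \<Omega> by (auto simp: frontier_def interior_open)
  then have "ball x r \<inter> \<Omega> \<noteq> {}" using r centre_in_ball[of x r] by blast
  ultimately have "ball x r \<inter> frontier \<Omega> \<noteq> {}"
    using connected_Int_frontier[OF connected_ball] by blast
  then show False using far by (fastforce simp: dist_commute)
qed

theorem theoremA:
  fixes \<Omega> :: "(complex ^ 'n) set" and f u v :: "complex ^ 'n \<Rightarrow> real"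
  assumes "open \<Omega>" and "connected \<Omega>" and "\<Omega> \<noteq> {}" and "bounded \<Omega>"
    and "continuous_on (closure \<Omega>) f" and "\<forall>z\<in>closure \<Omega>. f z > 0"
    and "bounded (u ` closure \<Omega>)" and "usc_on (closure \<Omega>) u"
    and "viscosity_subsolution \<Omega> f (\<lambda>z. ereal (u z))"
    and "bounded (v ` closure \<Omega>)" and "lsc_on (closure \<Omega>) v"
    and "viscosity_supersolution \<Omega> f (\<lambda>z. ereal (v z))"
    and "\<forall>z\<in>frontier \<Omega>. u z \<le> v z"
  shows "\<forall>z\<in>\<Omega>. u z \<le> v z"
proof (rule ccontr)
  assume "\<not> (\<forall>z\<in>\<Omega>. u z \<le> v z)"
  then obtain z where z: "z \<in> \<Omega>" "v z < u z" by auto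
  define m where "m = u z - v z"
  have m: "m > 0" using z by (simp add: m_def)
  define K where "K = closure \<Omega>"
  have zK: "z \<in> K" using z closure_subset by (auto simp: K_def)
  have K: "compact K" "K \<noteq> {}" using assms(4) zK by (auto simp: K_def)
  obtain M where M: "M > 0" "\<And>x. x \<in> K \<Longrightarrow> \<bar>u x\<bar> \<le> M"
    using assms(7) unfolding bounded_pos K_def by auto
  obtain R where R: "R > 0" "\<And>x. x \<in> K \<Longrightarrow> norm x \<le> R"
    using compact_imp_bounded[OF K(1)] unfolding bounded_pos by auto
  \<comment> \<open>With this \<open>\<delta>\<close> the strictness term \<open>\<delta> (|x|\<^sup>2 - R\<^sup>2)\<close> lies between \<open>- m / 4\<close> and \<open>0\<close> on \<open>K\<close>.\<close>
  define \<delta> where "\<delta> = m / (4 * R\<^sup>2)"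
  have \<delta>: "\<delta> > 0" "\<delta> * R\<^sup>2 = m / 4" using m R(1) by (auto simp: \<delta>_def)
  have fK: "frontier \<Omega> \<subseteq> K" by (simp add: K_def frontier_def)
  obtain \<rho>1 where \<rho>1: "\<rho>1 > 0"
    "\<forall>p\<in>frontier \<Omega>. \<forall>x\<in>K. \<forall>y\<in>K. dist p x < \<rho>1 \<longrightarrow> dist p y < \<rho>1 \<longrightarrow> u y < v x + m / 4"
  proof (rule ordered_on_compact_imp_uniformly_nearly_ordered)
    show "usc_on K u" "lsc_on K v" "frontier \<Omega> \<subseteq> K" using assms(8,11) fK by (simp_all add: K_def)
    show "compact (frontier \<Omega>)" by (rule compact_frontier_bounded[OF assms(4)])
    show "\<And>p. p \<in> frontier \<Omega> \<Longrightarrow> u p \<le> v p" using assms(13) by blast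
    show "0 < m / 4" using m by simp
  qed
  have "uniformly_continuous_on K f"
    using compact_uniformly_continuous assms(5) K(1) unfolding K_def by blast
  then obtain \<rho>2 where \<rho>2: "\<rho>2 > 0" "\<forall>x\<in>K. \<forall>y\<in>K. dist y x < \<rho>2 \<longrightarrow> dist (f y) (f x) < \<delta> / 2"
    unfolding uniformly_continuous_on_def using half_gt_zero[OF \<delta>(1)] by blast
  define \<rho> where "\<rho> = min \<rho>1 \<rho>2 / 2"
  have \<rho>: "\<rho> > 0" "2 * \<rho> \<le> \<rho>1" "2 * \<rho> \<le> \<rho>2" using \<rho>1(1) \<rho>2(1) by (auto simp: \<rho>_def)
  \<comment> \<open>Three steps of length at most \<open>s\<close> occur below: mollification, a circle, and the move to \<open>Y x\<close>.
  They have to stay within \<open>\<rho>\<close>.\<close>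
  define s where "s = \<rho> / 4"
  have s: "s > 0" using \<rho> by (simp add: s_def)
  \<comment> \<open>The slope makes it too expensive for the supremum to be attained farther than \<open>s\<close> away.\<close>
  define L where "L = 2 * M / s"
  have L: "L > 0" using M(1) s by (simp add: L_def)
  have uK: "usc_on K u" using assms(8) by (simp add: K_def)
  obtain w Y where Y0: "\<forall>x. Y x \<in> K" "\<forall>x. w x = u (Y x) - L * dist x (Y x)"
    and w0: "\<forall>x. \<forall>y\<in>K. u y - L * dist x y \<le> w x" "\<forall>x x'. w x \<le> w x' + L * dist x x'"
    by (rule Lipschitz_sup_convolution[OF K uK less_imp_le[OF L]])
  have Y: "Y x \<in> K" "w x = u (Y x) - L * dist x (Y x)" for x using Y0 by blast+
  have w: "y \<in> K \<Longrightarrow> u y - L * dist x y \<le> w x" "w x \<le> w x' + L * dist x x'" for x x' y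
    using w0 by blast+
  have near: "dist x (Y x) \<le> s" if x: "x \<in> K" for x
  proof -
    have "L * dist x (Y x) \<le> u (Y x) - u x" using w(1)[OF x, of x] Y(2)[of x] by simp
    also have "\<dots> \<le> 2 * M" using M(2)[OF x] M(2)[OF Y(1)[of x]] by linarith
    also have "\<dots> = L * s" using s by (simp add: L_def)
    finally show ?thesis using L by simp
  qed
  \<comment> \<open>Within this radius the \<open>L\<close>-Lipschitz function \<open>w\<close> varies by at most \<open>m / 8\<close>.\<close>
  define r where "r = min s (m / (8 * L))"
  have r: "r > 0" "r \<le> s" "L * r \<le> m / 8"
  proof -
    show "r > 0" "r \<le> s" using s m L by (auto simp: r_def)
    have "L * r \<le> L * (m / (8 * L))" using L by (intro mult_left_mono) (auto simp: r_def)
    then show "L * r \<le> m / 8" using L by simp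
  qed
  have lip: "w x - m / 8 \<le> w (x + y)" "w (x + y) \<le> w x + m / 8" if "norm y \<le> r" for x y
  proof -
    have "L * norm y \<le> L * r" using that L by simp
    moreover have "w (x + y) \<le> w x + L * norm y" "w x \<le> w (x + y) + L * norm y"
      using w(2)[of "x + y" x] w(2)[of x "x + y"] by (simp_all add: dist_norm)
    ultimately show "w x - m / 8 \<le> w (x + y)" "w (x + y) \<le> w x + m / 8" using r(3) by linarith+
  qed
  have wcont: "continuous_on UNIV w"
  proof -
    have "L-lipschitz_on UNIV w"
    proof (rule lipschitz_onI)
      fix x y show "dist (w x) (w y) \<le> L * dist x y"
        using w(2)[of x y] w(2)[of y x] by (simp add: dist_real_def dist_commute)
    qed (use L in auto)
    then show ?thesis by (rule lipschitz_on_continuous_on)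
  qed
  obtain W W'' where W: "has_hessian_on UNIV W W''"
    and Wle: "\<forall>x\<in>cball 0 (R + s). \<forall>C. (\<forall>y. norm y \<le> r \<longrightarrow> w (x + y) \<le> C) \<longrightarrow> W x \<le> C"
    and Wge: "\<forall>x\<in>cball 0 (R + s). \<forall>C. (\<forall>y. norm y \<le> r \<longrightarrow> C \<le> w (x + y)) \<longrightarrow> C \<le> W x"
    and Wlevi: "\<forall>x c \<rho>. \<rho> > 0 \<longrightarrow> cball x \<rho> \<subseteq> cball 0 (R + s) \<longrightarrow>
       (\<forall>y \<eta>. norm y \<le> r \<longrightarrow> norm \<eta> < \<rho> \<longrightarrow> w (x + y) + c * (norm \<eta>)\<^sup>2 \<le> circle_mean w (x + y) \<eta>)
       \<longrightarrow> (\<forall>\<xi>. c * (norm \<xi>)\<^sup>2 \<le> levi (W'' x) \<xi>)"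
    by (rule smooth_approximation[OF wcont bounded_cball r(1)])
  obtain S'' :: "complex ^ 'n \<Rightarrow> (complex ^ 'n) \<Rightarrow>\<^sub>L (complex ^ 'n) \<Rightarrow>\<^sub>L real"
    where S: "has_hessian_on UNIV (\<lambda>z. (norm z)\<^sup>2) S''" "\<And>z \<xi>. levi (S'' z) \<xi> = (norm \<xi>)\<^sup>2"
    using norm_square_levi by blast
  define q where "q x = W x + (\<delta> * (norm x)\<^sup>2 + - (\<delta> * R\<^sup>2))" for x
  define q'' where "q'' x = W'' x + (\<delta> *\<^sub>R S'' x + 0)" for x
  have q: "has_hessian_on UNIV q q''"
    unfolding q_def q''_def
    by (intro has_hessian_on_add W has_hessian_on_cmult S(1) has_hessian_on_const)
  have levi_q: "levi (q'' x) \<xi> = levi (W'' x) \<xi> + \<delta> * (norm \<xi>)\<^sup>2" for x \<xi>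
    unfolding q''_def S(2)[of x \<xi>, symmetric]
    by (simp add: levi_def blinfun.add_left blinfun.scaleR_left algebra_simps add_divide_distrib)
  have "usc_on K (\<lambda>x. - v x + q x)"
    using usc_on_uminus assms(11) continuous_on_subset[OF has_hessian_on_imp_continuous_on[OF q]]
    unfolding K_def by (intro usc_on_add_continuous) auto
  then obtain x0 where x0: "x0 \<in> K" "\<forall>x\<in>K. - v x + q x \<le> - v x0 + q x0"
    by (rule usc_on_attains_sup[OF K])
  have KV: "x \<in> cball 0 (R + s)" if "x \<in> K" for x using R(2)[OF that] s by simp
  have sq: "0 \<le> \<delta> * (norm x)\<^sup>2" "\<delta> * (norm x)\<^sup>2 \<le> \<delta> * R\<^sup>2" if "x \<in> K" for x
    using R(2)[OF that] R(1) \<delta>(1) by (auto intro!: mult_left_mono power_mono)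
  have "u z - m / 8 \<le> W z"
  proof (rule Wge[rule_format, OF KV[OF zK]])
    fix y :: "complex ^ 'n" assume "norm y \<le> r"
    then show "u z - m / 8 \<le> w (z + y)" using lip(1)[of y z] w(1)[OF zK, of z] by simp
  qed
  then have "5 / 8 * m \<le> - v z + q z"
    using sq(1)[OF zK] \<delta>(2) unfolding q_def m_def by (simp add: field_simps)
  then have big: "5 / 8 * m \<le> - v x0 + q x0" using x0(2) zK by fastforce
  show False
  \<comment> \<open>Near the boundary the values contradict \<open>u \<le> v\<close> there; away from it the Hessian contradicts
  the supersolution property.\<close>
  proof (cases "\<exists>p\<in>frontier \<Omega>. dist p x0 < \<rho>")
    case True
    then obtain p where p: "p \<in> frontier \<Omega>" "dist p x0 < \<rho>" by blast
    have "dist p (Y x0) < \<rho>1"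
      using dist_triangle[of p "Y x0" x0] near[OF x0(1)] p(2) \<rho> s by (simp add: s_def)
    then have "u (Y x0) < v x0 + m / 4"
      using \<rho>1(2)[rule_format, OF p(1) x0(1) Y(1)] p(2) \<rho> by simp
    moreover have "w x0 \<le> u (Y x0)" using Y(2)[of x0] L by simp
    ultimately have wx0: "w x0 \<le> v x0 + m / 4" by simp
    have "W x0 \<le> v x0 + m / 4 + m / 8"
    proof (rule Wle[rule_format, OF KV[OF x0(1)]])
      fix y :: "complex ^ 'n" assume "norm y \<le> r"
      then show "w (x0 + y) \<le> v x0 + m / 4 + m / 8" using lip(2)[of y x0] wx0 by simp
    qed
    then have "- v x0 + q x0 \<le> m / 4 + m / 8" using sq(2)[OF x0(1)] by (simp add: q_def)
    then show False using big m by simp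
  next
    case False
    have sub: "ball x0 \<rho> \<subseteq> \<Omega>"
      by (rule ball_subset_if_disjoint_frontier[OF assms(1)])
         (use x0(1) False \<rho>(1) in \<open>auto simp: K_def not_less\<close>)
    have x0\<Omega>: "x0 \<in> \<Omega>" using sub \<rho>(1) by auto
    have \<Omega>K: "\<Omega> \<subseteq> K" by (simp add: K_def closure_subset)
    \<comment> \<open>By the modulus of continuity of \<open>f\<close>, replacing \<open>f\<close> by its value at \<open>x0\<close> costs \<open>\<delta> / 2\<close>; passing to
  the strictly smaller constant that the circle mean inequality asks for costs another \<open>\<delta> / 4\<close>.
  The strictness term \<open>\<delta>\<close> more than compensates.\<close>
    have visc: "viscosity_levi_ge w (cball (x0 + y) s) (f x0 - \<delta> / 2)" if y: "norm y \<le> r" for y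
    proof (rule viscosity_levi_ge_sup_convolution[OF assms(1,9), where Y = Y and L = L])
      fix x assume x: "x \<in> cball (x0 + y) s"
      have "dist x0 x \<le> dist x0 (x0 + y) + dist (x0 + y) x" by (rule dist_triangle)
      also have "\<dots> \<le> s + s" using x y r(2) by (intro add_mono) (auto simp: dist_norm)
      finally have d1: "dist x0 x \<le> 2 * s" by simp
      then have "x \<in> \<Omega>" using sub s by (auto simp: s_def)
      then have "dist x (Y x) \<le> s" using near \<Omega>K by blast
      then have d2: "dist x0 (Y x) < \<rho>" using dist_triangle[of x0 "Y x" x] d1 s by (simp add: s_def)
      then have Y\<Omega>: "Y x \<in> \<Omega>" using sub by auto
      have "dist (f (Y x)) (f x0) < \<delta> / 2"
        using \<rho>2(2)[rule_format, OF x0(1) Y(1)] d2 \<rho> by (simp add: dist_commute)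
      then have "f x0 - \<delta> / 2 \<le> f (Y x)" unfolding dist_real_def by linarith
      then show "Y x \<in> \<Omega> \<and> f x0 - \<delta> / 2 \<le> f (Y x) \<and> w x = u (Y x) - L * dist x (Y x)"
        using Y\<Omega> Y(2) by blast
    qed (use w(1) \<Omega>K in blast)
    have Wx0: "(f x0 - 3 / 4 * \<delta>) * (norm \<xi>)\<^sup>2 \<le> levi (W'' x0) \<xi>" for \<xi>
    proof (rule Wlevi[rule_format, OF s])
      show "cball x0 s \<subseteq> cball 0 (R + s)" using R(2)[OF x0(1)] by (intro cball_subset_cball_iff[THEN iffD2]) (auto)
      fix y \<eta> :: "complex ^ 'n" assume y: "norm y \<le> r" and \<eta>: "norm \<eta> < s"
      show "w (x0 + y) + (f x0 - 3 / 4 * \<delta>) * (norm \<eta>)\<^sup>2 \<le> circle_mean w (x0 + y) \<eta>"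
        by (rule circle_mean_ge_of_viscosity[OF continuous_on_subset[OF wcont] visc[OF y] _ \<eta>])
           (use \<delta>(1) in auto)
    qed
    have "(f x0 + \<delta> / 4) * (norm \<xi>)\<^sup>2 \<le> levi (q'' x0) \<xi>" for \<xi>
      unfolding levi_q using Wx0[of \<xi>] by (simp add: algebra_simps)
    moreover have "has_hessian_on \<Omega> q q''"
      by (rule has_hessian_on_subset[OF q]) simp
    moreover have "v x0 - q x0 \<le> v x - q x" if "x \<in> \<Omega>" for x
      using x0(2) \<Omega>K that by fastforce
    ultimately show False
      using supersolution_not_touched_below[OF assms(12,1) x0\<Omega>, of q q'' "f x0 + \<delta> / 4"] \<delta>(1) by simp
  qed
qed

end
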